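(* There exist virtual RAAGs of the form $A_\phi=A_\Gamma\rtimes_\phi\langle t\rangle$, where $\phi\in\mathrm{Aut}(A_\Gamma)$ is a finite order non-length-preserving automorphism, such that the language $\mathsf{ConjGeo}_\phi(A_\Gamma,X)$ is not context-free.
   Context: For a finite simple graph $\Gamma$, $A_\Gamma$ is the right-angled Artin group (RAAG) generated by $V(\Gamma)$ with relations $st=ts$ whenever $\{s,t\}\in E(\Gamma)$; its standard generating set is $X=V(\Gamma)^{\pm1}$. In $A_\phi=A_\Gamma\rtimes_\phi\langle t\rangle$, $t$ has finite order $m$ with $\phi^m=\mathrm{id}$, and $t^{-1}xt=\phi(x)$ for $x\in X$. $|g|$ is the length of a shortest word over $X$ representing $g\in A_\Gamma$, $\pi:X^{\ast}\to A_\Gamma$ is the natural projection, $l(w)$ is word length. An automorphism $\phi$ is length-preserving if $|\phi(g)|=|g|$ for all $g$, and non-length-preserving otherwise. Elements $u,v$ are $\phi$-conjugate if $u=\phi(x)^{-1}vx$ for some $x\in A_\Gamma$. $\mathsf{ConjGeo}_\phi(A_\Gamma,X)=\{w\in X^{\ast}: l(w)=\min\{|h|: h\text{ is }\phi\text{-conjugate to }\pi(w)\}\}$. *)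

theory Defs
  imports "HOL-Algebra.Bij"
begin

section \<open>Right-angled Artin groups\<close>

definition finite_simple_graph :: "'v set \<Rightarrow> 'v set set \<Rightarrow> bool" where
  "finite_simple_graph V E \<longleftrightarrow> finite V \<and> (\<forall>e\<in>E. e \<subseteq> V \<and> card e = 2)"

text \<open>The letter \<^term>\<open>(v, True)\<close> stands for the generator \<^term>\<open>v\<close>, and
  \<^term>\<open>(v, False)\<close> for its formal inverse.\<close>

type_synonym 'v letter = "'v \<times> bool"
type_synonym 'v word = "'v letter list"

definition letters :: "'v set \<Rightarrow> 'v letter set" where
  "letters V = V \<times> UNIV"

definition inv_word :: "'v word \<Rightarrow> 'v word" where
  "inv_word w = rev (map (\<lambda>(v, b). (v, \<not> b)) w)"

text \<open>Two words over the letters are related iff they represent the same element of the group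
  presented by generators \<^term>\<open>V\<close> and relations \<open>s t = t s\<close> for \<^prop>\<open>{s, t} \<in> E\<close>.\<close>

inductive_set raag_rel :: "'v set \<Rightarrow> 'v set set \<Rightarrow> ('v word \<times> 'v word) set"
  for V :: "'v set" and E :: "'v set set" where
  refl: "w \<in> lists (letters V) \<Longrightarrow> (w, w) \<in> raag_rel V E"
| sym: "(u, w) \<in> raag_rel V E \<Longrightarrow> (w, u) \<in> raag_rel V E"
| trans: "(u, v) \<in> raag_rel V E \<Longrightarrow> (v, w) \<in> raag_rel V E \<Longrightarrow> (u, w) \<in> raag_rel V E"
| cancel: "v \<in> V \<Longrightarrow> u \<in> lists (letters V) \<Longrightarrow> w \<in> lists (letters V)
    \<Longrightarrow> (u @ [(v, b), (v, \<not> b)] @ w, u @ w) \<in> raag_rel V E"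
| commute: "s \<in> V \<Longrightarrow> t \<in> V \<Longrightarrow> {s, t} \<in> E
    \<Longrightarrow> u \<in> lists (letters V) \<Longrightarrow> w \<in> lists (letters V)
    \<Longrightarrow> (u @ [(s, True), (t, True)] @ w, u @ [(t, True), (s, True)] @ w) \<in> raag_rel V E"

text \<open>The natural projection from words to group elements.\<close>

definition raag_proj :: "'v set \<Rightarrow> 'v set set \<Rightarrow> 'v word \<Rightarrow> 'v word set" where
  "raag_proj V E w = raag_rel V E `` {w}"

definition raag :: "'v set \<Rightarrow> 'v set set \<Rightarrow> 'v word set monoid" where
  "raag V E = \<lparr> carrier = lists (letters V) // raag_rel V E,
     mult = (\<lambda>A B. \<Union>u\<in>A. \<Union>w\<in>B. raag_proj V E (u @ w)),
     one = raag_proj V E [] \<rparr>"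

definition raag_length :: "'v set \<Rightarrow> 'v set set \<Rightarrow> 'v word set \<Rightarrow> nat" where
  "raag_length V E g = (LEAST n. \<exists>w \<in> lists (letters V). raag_proj V E w = g \<and> length w = n)"

definition length_preserving ::
    "'v set \<Rightarrow> 'v set set \<Rightarrow> ('v word set \<Rightarrow> 'v word set) \<Rightarrow> bool" where
  "length_preserving V E \<phi> \<longleftrightarrow>
     (\<forall>g \<in> carrier (raag V E). raag_length V E (\<phi> g) = raag_length V E g)"

lemma raag_rel_words:
  "(u, w) \<in> raag_rel V E \<Longrightarrow> u \<in> lists (letters V) \<and> w \<in> lists (letters V)"
  by (induction rule: raag_rel.induct) (auto simp: letters_def)

lemma equiv_raag_rel: "equiv (lists (letters V)) (raag_rel V E)"
proof (rule equivI)
  show "raag_rel V E \<subseteq> lists (letters V) \<times> lists (letters V)"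
    using raag_rel_words by fast
  show "refl_on (lists (letters V)) (raag_rel V E)"
    by (auto intro!: refl_onI raag_rel.refl)
  show "Relation.sym (raag_rel V E)" by (auto intro: symI raag_rel.sym)
  show "Relation.trans (raag_rel V E)" by (meson transI raag_rel.trans)
qed

lemma raag_rel_append_left:
  assumes "(u, w) \<in> raag_rel V E" and x: "x \<in> lists (letters V)"
  shows "(x @ u, x @ w) \<in> raag_rel V E"
  using assms(1)
proof induction
  case (refl w) then show ?case using x by (auto intro!: raag_rel.refl)
next
  case sym then show ?case by (blast intro: raag_rel.sym)
next
  case trans then show ?case by (blast intro: raag_rel.trans)
next
  case (cancel v u w b)
  then show ?case using raag_rel.cancel[of v V "x @ u" w b E] x by simp
next
  case (commute s t u w)
  then show ?case using raag_rel.commute[of s V t E "x @ u" w] x by simp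
qed

lemma raag_rel_append_right:
  assumes "(u, w) \<in> raag_rel V E" and x: "x \<in> lists (letters V)"
  shows "(u @ x, w @ x) \<in> raag_rel V E"
  using assms(1)
proof induction
  case (refl w) then show ?case using x by (auto intro!: raag_rel.refl)
next
  case sym then show ?case by (blast intro: raag_rel.sym)
next
  case trans then show ?case by (blast intro: raag_rel.trans)
next
  case (cancel v u w b)
  then show ?case using raag_rel.cancel[of v V u "w @ x" b E] x by simp
next
  case (commute s t u w)
  then show ?case using raag_rel.commute[of s V t E u "w @ x"] x by simp
qed

lemma raag_rel_append:
  assumes "(u, u') \<in> raag_rel V E" "(w, w') \<in> raag_rel V E"
  shows "(u @ w, u' @ w') \<in> raag_rel V E"
  using assms raag_rel_append_left raag_rel_append_right raag_rel_words
  by (meson raag_rel.trans)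

lemma raag_proj_eq_iff:
  assumes "u \<in> lists (letters V)" "w \<in> lists (letters V)"
  shows "raag_proj V E u = raag_proj V E w \<longleftrightarrow> (u, w) \<in> raag_rel V E"
  unfolding raag_proj_def using eq_equiv_class_iff[OF equiv_raag_rel] assms by blast

lemma carrier_raag: "carrier (raag V E) = raag_proj V E ` lists (letters V)"
  by (auto simp: raag_def raag_proj_def quotient_def)

lemma raag_proj_closed: "w \<in> lists (letters V) \<Longrightarrow> raag_proj V E w \<in> carrier (raag V E)"
  by (simp add: carrier_raag)

lemma raag_one: "\<one>\<^bsub>raag V E\<^esub> = raag_proj V E []"
  by (simp add: raag_def)

lemma raag_mult:
  assumes "u \<in> lists (letters V)" "w \<in> lists (letters V)"
  shows "raag_proj V E u \<otimes>\<^bsub>raag V E\<^esub> raag_proj V E w = raag_proj V E (u @ w)"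
proof -
  have "raag_proj V E (u' @ w') = raag_proj V E (u @ w)"
    if "u' \<in> raag_proj V E u" "w' \<in> raag_proj V E w" for u' w'
  proof -
    from that have r: "(u, u') \<in> raag_rel V E" "(w, w') \<in> raag_rel V E"
      by (auto simp: raag_proj_def)
    then have "(u' @ w', u @ w) \<in> raag_rel V E"
      by (blast intro: raag_rel.sym raag_rel_append)
    then show ?thesis
      using raag_proj_eq_iff[of "u' @ w'" V "u @ w" E] raag_rel_words by blast
  qed
  moreover have "u \<in> raag_proj V E u" "w \<in> raag_proj V E w"
    using assms by (auto simp: raag_proj_def intro: raag_rel.refl)
  ultimately have "(\<Union>u'\<in>raag_proj V E u. \<Union>w'\<in>raag_proj V E w. raag_proj V E (u' @ w'))
      = raag_proj V E (u @ w)" by blast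
  then show ?thesis by (simp add: raag_def)
qed

lemma inv_word_closed: "w \<in> lists (letters V) \<Longrightarrow> inv_word w \<in> lists (letters V)"
  by (induction w) (auto simp: inv_word_def letters_def)

lemma inv_word_cancel:
  "w \<in> lists (letters V) \<Longrightarrow> (inv_word w @ w, []) \<in> raag_rel V E"
proof (induction w)
  case Nil
  then show ?case by (auto simp: inv_word_def intro: raag_rel.refl)
next
  case (Cons a w)
  obtain v b where a: "a = (v, b)" by (cases a)
  have "(inv_word w @ [(v, \<not> b), (v, \<not> \<not> b)] @ w, inv_word w @ w) \<in> raag_rel V E"
    by (rule raag_rel.cancel) (use Cons.prems a inv_word_closed in \<open>auto simp: letters_def\<close>)
  moreover have "inv_word (a # w) @ a # w = inv_word w @ [(v, \<not> b), (v, \<not> \<not> b)] @ w"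
    by (simp add: inv_word_def a)
  moreover have "(inv_word w @ w, []) \<in> raag_rel V E" using Cons by simp
  ultimately show ?case by (metis raag_rel.trans)
qed

lemma group_raag: "group (raag V E)"
proof (rule groupI)
  fix x y z
  assume "x \<in> carrier (raag V E)" "y \<in> carrier (raag V E)" "z \<in> carrier (raag V E)"
  then obtain u v w where
    "u \<in> lists (letters V)" "v \<in> lists (letters V)" "w \<in> lists (letters V)"
    "x = raag_proj V E u" "y = raag_proj V E v" "z = raag_proj V E w"
    unfolding carrier_raag by blast
  then show "x \<otimes>\<^bsub>raag V E\<^esub> y \<otimes>\<^bsub>raag V E\<^esub> z = x \<otimes>\<^bsub>raag V E\<^esub> (y \<otimes>\<^bsub>raag V E\<^esub> z)"
    by (simp add: raag_mult)
next
  fix x y assume "x \<in> carrier (raag V E)" "y \<in> carrier (raag V E)"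
  then obtain u v where "u \<in> lists (letters V)" "v \<in> lists (letters V)"
    "x = raag_proj V E u" "y = raag_proj V E v"
    unfolding carrier_raag by blast
  then show "x \<otimes>\<^bsub>raag V E\<^esub> y \<in> carrier (raag V E)"
    by (simp add: raag_mult raag_proj_closed)
next
  show "\<one>\<^bsub>raag V E\<^esub> \<in> carrier (raag V E)" by (simp add: raag_one carrier_raag)
next
  fix x assume "x \<in> carrier (raag V E)"
  then obtain w where w: "w \<in> lists (letters V)" "x = raag_proj V E w"
    unfolding carrier_raag by blast
  then show "\<one>\<^bsub>raag V E\<^esub> \<otimes>\<^bsub>raag V E\<^esub> x = x" by (simp add: raag_one raag_mult)
  have "raag_proj V E (inv_word w) \<otimes>\<^bsub>raag V E\<^esub> x = raag_proj V E []"
    using w inv_word_closed[OF w(1)] inv_word_cancel[OF w(1), of E]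
      raag_proj_eq_iff[of "inv_word w @ w" V "[]" E]
    by (simp add: raag_mult)
  then show "\<exists>y\<in>carrier (raag V E). y \<otimes>\<^bsub>raag V E\<^esub> x = \<one>\<^bsub>raag V E\<^esub>"
    using w inv_word_closed raag_proj_closed raag_one by metis
qed


section \<open>Virtual right-angled Artin groups\<close>

text \<open>The semidirect product of \<^term>\<open>raag V E\<close> with a cyclic group of order \<^term>\<open>m\<close> generated
  by \<open>t\<close>: the pair \<open>(i, g)\<close> stands for \<open>t\<^sup>i g\<close>. The relation \<open>t\<^sup>-\<^sup>1 g t = \<phi> g\<close>
  yields \<open>(t\<^sup>i g) (t\<^sup>j h) = t\<^sup>i\<^sup>+\<^sup>j \<phi>\<^sup>j(g) h\<close>.\<close>

definition virtual_raag ::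
    "'v set \<Rightarrow> 'v set set \<Rightarrow> ('v word set \<Rightarrow> 'v word set) \<Rightarrow> nat \<Rightarrow> (nat \<times> 'v word set) monoid" where
  "virtual_raag V E \<phi> m = \<lparr> carrier = {..<m} \<times> carrier (raag V E),
     mult = (\<lambda>(i, g) (j, h). ((i + j) mod m, (\<phi> ^^ j) g \<otimes>\<^bsub>raag V E\<^esub> h)),
     one = (0, \<one>\<^bsub>raag V E\<^esub>) \<rparr>"

context
  fixes V :: "'v set" and E :: "'v set set" and \<phi> :: "'v word set \<Rightarrow> 'v word set" and m :: nat
  assumes aut: "\<phi> \<in> auto (raag V E)"
    and m_pos: "0 < m"
    and funpow_m: "\<forall>g \<in> carrier (raag V E). (\<phi> ^^ m) g = g"
begin

interpretation A: group "raag V E" by (rule group_raag)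

lemma funpow_hom: "(\<phi> ^^ n) \<in> hom (raag V E) (raag V E)"
proof (induction n)
  case 0
  then show ?case by (simp add: hom_def)
next
  case (Suc n)
  moreover have "\<phi> \<in> hom (raag V E) (raag V E)" using aut by (simp add: auto_def)
  ultimately show ?case by (auto simp: hom_def Pi_iff)
qed

lemma funpow_closed [simp]: "g \<in> carrier (raag V E) \<Longrightarrow> (\<phi> ^^ n) g \<in> carrier (raag V E)"
  using funpow_hom by (auto simp: hom_def)

lemma funpow_times_m: "g \<in> carrier (raag V E) \<Longrightarrow> (\<phi> ^^ (m * k)) g = g"
proof (induction k)
  case (Suc k)
  then show ?case using funpow_m by (simp add: funpow_add)
qed simp

lemma funpow_mod:
  assumes "g \<in> carrier (raag V E)"
  shows "(\<phi> ^^ (n mod m)) g = (\<phi> ^^ n) g"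
proof -
  have "(\<phi> ^^ n) g = (\<phi> ^^ (n mod m + m * (n div m))) g" by simp
  also have "\<dots> = (\<phi> ^^ (n mod m)) ((\<phi> ^^ (m * (n div m))) g)"
    by (simp only: funpow_add o_apply)
  finally show ?thesis using assms by (simp add: funpow_times_m)
qed

lemma group_virtual_raag: "group (virtual_raag V E \<phi> m)"
proof (rule groupI)
  fix x y z
  assume "x \<in> carrier (virtual_raag V E \<phi> m)" "y \<in> carrier (virtual_raag V E \<phi> m)"
    "z \<in> carrier (virtual_raag V E \<phi> m)"
  then obtain i g j h k l where
    e: "x = (i, g)" "y = (j, h)" "z = (k, l)" and
    c: "g \<in> carrier (raag V E)" "h \<in> carrier (raag V E)" "l \<in> carrier (raag V E)"
    by (auto simp: virtual_raag_def)
  have "(\<phi> ^^ k) ((\<phi> ^^ j) g \<otimes>\<^bsub>raag V E\<^esub> h) = (\<phi> ^^ (k + j)) g \<otimes>\<^bsub>raag V E\<^esub> (\<phi> ^^ k) h"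
    using hom_mult[OF funpow_hom, of "(\<phi> ^^ j) g" h k] c by (simp add: funpow_add)
  moreover have "(\<phi> ^^ ((j + k) mod m)) g = (\<phi> ^^ (k + j)) g"
    using funpow_mod[OF c(1), of "j + k"] by (simp add: add.commute)
  ultimately show "x \<otimes>\<^bsub>virtual_raag V E \<phi> m\<^esub> y \<otimes>\<^bsub>virtual_raag V E \<phi> m\<^esub> z
      = x \<otimes>\<^bsub>virtual_raag V E \<phi> m\<^esub> (y \<otimes>\<^bsub>virtual_raag V E \<phi> m\<^esub> z)"
    using c by (simp add: virtual_raag_def e A.m_assoc mod_simps add.assoc)
next
  fix x y
  assume "x \<in> carrier (virtual_raag V E \<phi> m)" "y \<in> carrier (virtual_raag V E \<phi> m)"
  then show "x \<otimes>\<^bsub>virtual_raag V E \<phi> m\<^esub> y \<in> carrier (virtual_raag V E \<phi> m)"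
    using m_pos by (auto simp: virtual_raag_def)
next
  show "\<one>\<^bsub>virtual_raag V E \<phi> m\<^esub> \<in> carrier (virtual_raag V E \<phi> m)"
    using m_pos by (simp add: virtual_raag_def)
next
  fix x assume "x \<in> carrier (virtual_raag V E \<phi> m)"
  then obtain i g where x: "x = (i, g)" "i < m" "g \<in> carrier (raag V E)"
    by (auto simp: virtual_raag_def)
  have one: "(\<phi> ^^ n) \<one>\<^bsub>raag V E\<^esub> = \<one>\<^bsub>raag V E\<^esub>" for n
    using hom_one[OF funpow_hom] group_raag by blast
  show "\<one>\<^bsub>virtual_raag V E \<phi> m\<^esub> \<otimes>\<^bsub>virtual_raag V E \<phi> m\<^esub> x = x"
    using x by (simp add: virtual_raag_def one)
  let ?y = "((m - i) mod m, (\<phi> ^^ (m - i)) (inv\<^bsub>raag V E\<^esub> g))"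
  have "(\<phi> ^^ i) ((\<phi> ^^ (m - i)) (inv\<^bsub>raag V E\<^esub> g)) = (\<phi> ^^ (i + (m - i))) (inv\<^bsub>raag V E\<^esub> g)"
    by (simp only: funpow_add o_apply)
  also have "\<dots> = inv\<^bsub>raag V E\<^esub> g" using x funpow_m by simp
  finally have "?y \<otimes>\<^bsub>virtual_raag V E \<phi> m\<^esub> x = \<one>\<^bsub>virtual_raag V E \<phi> m\<^esub>"
    using x by (simp add: virtual_raag_def mod_simps)
  moreover have "?y \<in> carrier (virtual_raag V E \<phi> m)"
    using x m_pos by (simp add: virtual_raag_def)
  ultimately show "\<exists>y\<in>carrier (virtual_raag V E \<phi> m).
      y \<otimes>\<^bsub>virtual_raag V E \<phi> m\<^esub> x = \<one>\<^bsub>virtual_raag V E \<phi> m\<^esub>" by blast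
qed

lemma virtual_raag_relation:
  assumes "g \<in> carrier (raag V E)"
  defines "t \<equiv> (1 mod m, \<one>\<^bsub>raag V E\<^esub>)"
  shows "inv\<^bsub>virtual_raag V E \<phi> m\<^esub> t \<otimes>\<^bsub>virtual_raag V E \<phi> m\<^esub> (0, g) \<otimes>\<^bsub>virtual_raag V E \<phi> m\<^esub> t = (0, \<phi> g)"
proof -
  interpret G: group "virtual_raag V E \<phi> m" by (rule group_virtual_raag)
  have t: "t \<in> carrier (virtual_raag V E \<phi> m)" and
    g: "(0, g) \<in> carrier (virtual_raag V E \<phi> m)" and
    pg: "(0, \<phi> g) \<in> carrier (virtual_raag V E \<phi> m)"
    using assms(1) m_pos funpow_closed[OF assms(1), of 1]
    by (auto simp: virtual_raag_def t_def)
  have "(\<phi> ^^ (1 mod m)) g = \<phi> g" using funpow_mod[OF assms(1), of 1] by simp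
  then have "(0, g) \<otimes>\<^bsub>virtual_raag V E \<phi> m\<^esub> t = t \<otimes>\<^bsub>virtual_raag V E \<phi> m\<^esub> (0, \<phi> g)"
    using assms(1) funpow_closed[OF assms(1), of 1]
    by (simp add: virtual_raag_def t_def)
  then show ?thesis
    using t g pg by (simp add: G.m_assoc G.inv_solve_left')
qed

end


section \<open>Twisted conjugacy geodesics\<close>

definition twisted_conj ::
    "('a, 'b) monoid_scheme \<Rightarrow> ('a \<Rightarrow> 'a) \<Rightarrow> 'a \<Rightarrow> 'a \<Rightarrow> bool" where
  "twisted_conj G \<phi> u v \<longleftrightarrow> u \<in> carrier G \<and> v \<in> carrier G \<and>
     (\<exists>x \<in> carrier G. u = inv\<^bsub>G\<^esub> (\<phi> x) \<otimes>\<^bsub>G\<^esub> v \<otimes>\<^bsub>G\<^esub> x)"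

definition ConjGeo ::
    "'v set \<Rightarrow> 'v set set \<Rightarrow> ('v word set \<Rightarrow> 'v word set) \<Rightarrow> 'v word set" where
  "ConjGeo V E \<phi> = {w \<in> lists (letters V).
     length w = (LEAST n. \<exists>h. twisted_conj (raag V E) \<phi> h (raag_proj V E w) \<and> raag_length V E h = n)}"


section \<open>Context-free languages\<close>

datatype ('n, 't) symb = NT 'n | Tm 't

type_synonym ('n, 't) prods = "('n \<times> ('n, 't) symb list) set"

inductive derive_step :: "('n, 't) prods \<Rightarrow> ('n, 't) symb list \<Rightarrow> ('n, 't) symb list \<Rightarrow> bool"
  for P where
  "(A, \<alpha>) \<in> P \<Longrightarrow> derive_step P (u @ [NT A] @ v) (u @ \<alpha> @ v)"

definition cfg_language :: "('n, 't) prods \<Rightarrow> 'n \<Rightarrow> 't list set" where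
  "cfg_language P S = {w. (derive_step P)\<^sup>*\<^sup>* [NT S] (map Tm w)}"

text \<open>A grammar has finitely many productions, hence uses only finitely many nonterminals;
  these may therefore be taken to be natural numbers.\<close>

definition context_free :: "'t list set \<Rightarrow> bool" where
  "context_free L \<longleftrightarrow> (\<exists>(P :: (nat, 't) prods) S. finite P \<and> L = cfg_language P S)"

end

theory Submission
  imports Defs
begin

text \<open>
  Take the direct product of the free group on \<open>a, b, c, d\<close> with the infinite cyclic group generated
  by \<open>z\<close>: its graph joins \<open>z\<close> to each of four pairwise non-adjacent vertices. The vertices
  \<open>a, b, c, d, z\<close> are the numbers 0 to 4. Let \<open>\<phi>\<close> exchange \<open>a\<close> with \<open>b\<close> and \<open>c\<close> with \<open>d\<close> up to
  powers of the central generator: \<open>\<phi>(a) = b z\<close>, \<open>\<phi>(b) = a z\<^sup>-\<^sup>1\<close>, \<open>\<phi>(c) = d z\<close>,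
  \<open>\<phi>(d) = c z\<^sup>-\<^sup>1\<close>, \<open>\<phi>(z) = z\<close>. This is an involution that maps \<open>a\<close> to an element of length 2.

  Let \<open>\<sigma>\<close> be the underlying exchange of generators and let the slope of a word be its exponent sum
  in which \<open>a, c\<close> count \<open>1\<close> and \<open>b, d\<close> count \<open>-1\<close>; then \<open>\<phi>(g) = \<sigma>(g) z\<close> to the slope of \<open>g\<close>,
  for \<open>g\<close> in the free factor. Conjugating \<open>p q z\<^sup>k\<close> in the twisted sense by \<open>\<sigma>(p)\<close> therefore moves
  the prefix \<open>p\<close> to the end as \<open>\<sigma>(p)\<close> and changes the exponent \<open>k\<close> by the slope of \<open>p\<close>; a suffix
  can be moved to the front in the same way. A positive word \<open>a\<^sup>i b\<^sup>j c\<^sup>k z\<close> thus becomes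
  shorter as soon as some prefix or some suffix has slope \<open>-1\<close>, and so it is a conjugacy geodesic
  only if \<open>j \<le> i\<close> and \<open>j \<le> k\<close> (lemma \<open>ConjGeo_pos_counts\<close>). Conversely \<open>a\<^sup>n b\<^sup>n c\<^sup>n z\<close> is a
  conjugacy geodesic: none of its rotations can lower the central exponent below \<open>1\<close>, and a
  conjugator that does not merely rotate lengthens the free part by at least as much as it can
  save on the central part (lemmas \<open>balanced_bound\<close> and \<open>block_word_ConjGeo\<close>).

  The inequalities \<open>j \<le> i\<close> and \<open>j \<le> k\<close> are incompatible with pumping, provided that pumped words
  still have the form \<open>a\<^sup>i b\<^sup>j c\<^sup>k z\<close>. This is ensured by a pumping lemma in which the letters of
  the two pumped factors already occur between them (lemma \<open>content_pumping\<close>); in a word sorted by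
  letters each pumped factor is then a power of a single letter, so pumping preserves sortedness.
  It replaces the intersection with a regular language in the usual argument.
\<close>

section \<open>Derivation trees and a pumping lemma\<close>

datatype ('n, 't) ptree = Leaf 't | Node 'n "('n, 't) ptree list"

fun root :: "('n, 't) ptree \<Rightarrow> ('n, 't) symb" where
  "root (Leaf a) = Tm a"
| "root (Node A ts) = NT A"

fun yield :: "('n, 't) ptree \<Rightarrow> 't list" where
  "yield (Leaf a) = [a]"
| "yield (Node A ts) = concat (map yield ts)"

fun valid :: "('n, 't) prods \<Rightarrow> ('n, 't) ptree \<Rightarrow> bool" where
  "valid P (Leaf a) \<longleftrightarrow> True"
| "valid P (Node A ts) \<longleftrightarrow> (A, map root ts) \<in> P \<and> (\<forall>t\<in>set ts. valid P t)"

lemma derivation_imp_trees: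
  assumes "(derive_step P)\<^sup>*\<^sup>* \<alpha> (map Tm w)"
  shows "\<exists>ts. map root ts = \<alpha> \<and> (\<forall>t\<in>set ts. valid P t) \<and> concat (map yield ts) = w"
  using assms
proof (induction rule: converse_rtranclp_induct)
  case base
  have "concat (map (\<lambda>a. [a]) w) = w" by (induction w) auto
  then show ?case by (intro exI[of _ "map Leaf w"]) (auto simp: comp_def)
next
  case (step \<alpha> \<beta>)
  from step.hyps(1) obtain A \<gamma> u v where
    e: "\<alpha> = u @ [NT A] @ v" "\<beta> = u @ \<gamma> @ v" "(A, \<gamma>) \<in> P"
    by (cases rule: derive_step.cases) auto
  from step.IH obtain ts where ts: "map root ts = u @ \<gamma> @ v"
    "\<forall>t\<in>set ts. valid P t" "concat (map yield ts) = w"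
    unfolding e by blast
  from ts(1) obtain ts1 ts2 ts3 where
    "ts = ts1 @ ts2 @ ts3" "map root ts1 = u" "map root ts2 = \<gamma>" "map root ts3 = v"
    by (auto simp: map_eq_append_conv append_eq_map_conv)
  with ts(2,3) have "map root ts1 = u" "map root ts2 = \<gamma>" "map root ts3 = v"
    "\<forall>t\<in>set (ts1 @ ts2 @ ts3). valid P t" "concat (map yield (ts1 @ ts2 @ ts3)) = w"
    by simp_all
  then show ?case
    by (intro exI[of _ "ts1 @ [Node A ts2] @ ts3"]) (auto simp: e)
qed

lemma derive_context:
  assumes "(derive_step P)\<^sup>*\<^sup>* \<alpha> \<beta>"
  shows "(derive_step P)\<^sup>*\<^sup>* (u @ \<alpha> @ v) (u @ \<beta> @ v)"
  using assms
proof (induction rule: rtranclp_induct)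
  case (step \<beta> \<gamma>)
  from step.hyps(2) obtain A \<delta> p q where
    "\<beta> = p @ [NT A] @ q" "\<gamma> = p @ \<delta> @ q" "(A, \<delta>) \<in> P"
    by (cases rule: derive_step.cases) auto
  then have "derive_step P (u @ \<beta> @ v) (u @ \<gamma> @ v)"
    using derive_step.intros[of A \<delta> P "u @ p" "q @ v"] by simp
  with step.IH show ?case by simp
qed simp

lemma tree_imp_derivation:
  "valid P t \<Longrightarrow> (derive_step P)\<^sup>*\<^sup>* [root t] (map Tm (yield t))"
proof (induction t)
  case (Node A ts)
  have "(derive_step P)\<^sup>*\<^sup>* (map root us) (map Tm (concat (map yield us)))"
    if "set us \<subseteq> set ts" for us
    using that
  proof (induction us)
    case (Cons t us)
    then have t: "(derive_step P)\<^sup>*\<^sup>* [root t] (map Tm (yield t))"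
      using Node by auto
    have us: "(derive_step P)\<^sup>*\<^sup>* (map root us) (map Tm (concat (map yield us)))"
      using Cons by simp
    show ?case
      using derive_context[OF t, of "[]" "map root us"]
        derive_context[OF us, of "map Tm (yield t)" "[]"] by simp
  qed simp
  moreover have "derive_step P [NT A] (map root ts)"
    using derive_step.intros[of A "map root ts" P "[]" "[]"] Node.prems by simp
  ultimately show ?case by (simp add: converse_rtranclp_into_rtranclp)
qed simp

lemma cfg_language_trees:
  "cfg_language P S = {yield t | t. valid P t \<and> root t = NT S}"
proof (rule equalityI; rule subsetI)
  fix w assume "w \<in> cfg_language P S"
  then have "(derive_step P)\<^sup>*\<^sup>* [NT S] (map Tm w)" by (simp add: cfg_language_def)
  from derivation_imp_trees[OF this] show "w \<in> {yield t | t. valid P t \<and> root t = NT S}"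
    by (auto simp: map_eq_Cons_conv)
next
  fix w assume "w \<in> {yield t | t. valid P t \<and> root t = NT S}"
  then show "w \<in> cfg_language P S"
    using tree_imp_derivation by (fastforce simp: cfg_language_def)
qed

text \<open>In \<open>occurs t u s v\<close> the words \<open>u\<close> and \<open>v\<close> are the parts of the yield of \<open>t\<close> to the left and to the
  right of one particular occurrence of the subtree \<open>s\<close>. Recording the two words instead of a
  position makes the effect of exchanging subtrees directly visible in the yields.\<close>

inductive occurs :: "('n, 't) ptree \<Rightarrow> 't list \<Rightarrow> ('n, 't) ptree \<Rightarrow> 't list \<Rightarrow> bool" where
  here: "occurs t [] t []"
| below: "occurs c u s v \<Longrightarrow>
    occurs (Node A (ls @ c # rs)) (concat (map yield ls) @ u) s (v @ concat (map yield rs))"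

lemma occurs_valid: "occurs t u s v \<Longrightarrow> valid P t \<Longrightarrow> valid P s"
  by (induction rule: occurs.induct) auto

lemma occurs_yield: "occurs t u s v \<Longrightarrow> yield t = u @ yield s @ v"
  by (induction rule: occurs.induct) auto

text \<open>The equation between sizes serves to compare trees with the same yield: exchanging a subtree for a
  smaller one makes the tree smaller.\<close>

lemma replace_subtree:
  assumes "occurs t u s v" "valid P t" "valid P s'" "root s' = root s"
  obtains t' where "valid P t'" "root t' = root t" "yield t' = u @ yield s' @ v"
    "size t' + size s = size t + size s'"
proof -
  have "\<exists>t'. valid P t' \<and> root t' = root t \<and> yield t' = u @ yield s' @ v
      \<and> size t' + size s = size t + size s'"
    using assms
  proof (induction rule: occurs.induct)
    case (here t)
    then show ?case by auto
  next
    case (below c u s v A ls rs)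
    then obtain c' where "valid P c'" "root c' = root c" "yield c' = u @ yield s' @ v"
      "size c' + size s = size c + size s'" by auto
    then show ?case using below.prems
      by (intro exI[of _ "Node A (ls @ c' # rs)"]) auto
  qed
  then show ?thesis using that by blast
qed

definition terminals :: "('n, 't) prods \<Rightarrow> 't set" where
  "terminals P = (\<Union>(A, \<alpha>)\<in>P. {a. Tm a \<in> set \<alpha>})"

lemma finite_terminals:
  fixes P :: "('n, 't) prods"
  assumes "finite P"
  shows "finite (terminals P)"
proof -
  have "finite {a. Tm a \<in> set \<alpha>}" for \<alpha> :: "('n, 't) symb list"
  proof (rule finite_subset)
    show "{a. Tm a \<in> set \<alpha>} \<subseteq> (\<lambda>s. case s of Tm a \<Rightarrow> a) ` set \<alpha>" by force
  qed simp
  then show ?thesis using assms by (auto simp: terminals_def)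
qed

lemma yield_terminals: "valid P t \<Longrightarrow> root t = NT A \<Longrightarrow> set (yield t) \<subseteq> terminals P"
proof (induction t arbitrary: A)
  case (Node B ts)
  have "set (yield t) \<subseteq> terminals P" if t: "t \<in> set ts" for t
  proof (cases t)
    case (Leaf a)
    then have "Tm a \<in> set (map root ts)" using t by force
    then show ?thesis using Node.prems Leaf unfolding terminals_def by fastforce
  next
    case (Node C us)
    moreover have "valid P t" using Node.prems(1) t by simp
    ultimately show ?thesis using Node.IH[OF t, of C] by simp
  qed
  then show ?case by auto
qed simp

text \<open>Besides the nonterminal at the root the label records which letters the yield contains. Only
  finitely many labels arise from a finite grammar, so labels repeat along long paths just as
  nonterminals do, and a repetition then means that pumping introduces no letters that are absent
  from the inner subtree.\<close>

definition label :: "('n, 't) ptree \<Rightarrow> ('n, 't) symb \<times> 't set" where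
  "label t = (root t, set (yield t))"

text \<open>If no label repeats along a path then the height of the tree is at most the number of labels, which
  bounds its yield. The induction keeps in \<open>seen\<close> the labels of the ancestors of \<open>t\<close>: each step
  down to a child with a longest yield divides the length by at most \<open>d\<close> and uses up one label.\<close>

lemma repeated_label:
  fixes d :: nat
  assumes labels: "finite LAB"
      "\<And>u s v A. occurs t u s v \<Longrightarrow> root s = NT A \<Longrightarrow> label s \<in> LAB"
    and width: "\<And>A \<alpha>. (A, \<alpha>) \<in> P \<Longrightarrow> length \<alpha> \<le> d" "0 < d"
    and "valid P t" "d ^ card (LAB - seen) < length (yield t)"
  shows "(\<exists>u s v. occurs t u s v \<and> label s \<in> seen) \<or>
    (\<exists>u s v u' s' v'. occurs t u s v \<and> occurs s u' s' v' \<and> size s' < size s \<and> label s' = label s)"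
  using labels(2) assms(5,6)
proof (induction t arbitrary: seen)
  case (Leaf a)
  then show ?case using width(2) by (simp add: not_less_iff_gr_or_eq Suc_leI)
next
  case (Node A ts)
  let ?t = "Node A ts"
  show ?case
  proof (cases "label ?t \<in> seen")
    case True
    then have "occurs ?t [] ?t [] \<and> label ?t \<in> seen" using occurs.here by simp
    then show ?thesis by (intro disjI1 exI)
  next
    case False
    let ?seen = "insert (label ?t) seen"
    have "label ?t \<in> LAB" using Node.prems(1)[OF occurs.here] by simp
    with False have "card (LAB - seen) = Suc (card (LAB - ?seen))"
      using labels(1) by (metis Diff_iff Diff_insert card_Suc_Diff1 finite_Diff)
    then have pow: "d ^ card (LAB - seen) = d * d ^ card (LAB - ?seen)" by simp
    have "\<exists>c\<in>set ts. d ^ card (LAB - ?seen) < length (yield c)"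
    proof (rule ccontr)
      assume "\<not> ?thesis"
      then have "\<forall>c\<in>set ts. length (yield c) \<le> d ^ card (LAB - ?seen)" by (simp add: not_less)
      moreover have "length (concat (map yield us)) \<le> length us * b"
        if "\<forall>c\<in>set us. length (yield c) \<le> b" for us :: "('a, 'b) ptree list" and b
        using that by (induction us) (auto simp: add_mono)
      ultimately have "length (concat (map yield ts)) \<le> length ts * d ^ card (LAB - ?seen)"
        by blast
      also have "\<dots> \<le> d ^ card (LAB - seen)"
        unfolding pow using width(1)[of A "map root ts"] Node.prems(2) by simp
      finally show False using Node.prems(3) by simp
    qed
    then obtain c where c: "c \<in> set ts" "d ^ card (LAB - ?seen) < length (yield c)" by blast
    from c(1) obtain ls rs where ts: "ts = ls @ c # rs" by (meson split_list)
    have lift: "\<exists>u' v'. occurs ?t u' s v'" if "occurs c u s v" for u s v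
      using occurs.below[OF that] unfolding ts by blast
    have smaller: "size s < size ?t" if "occurs c u s v" for u s v
    proof -
      have "size s \<le> size c" using that by (induction rule: occurs.induct) auto
      then show ?thesis by (simp add: ts)
    qed
    have "(\<exists>u s v. occurs c u s v \<and> label s \<in> ?seen) \<or>
      (\<exists>u s v u' s' v'. occurs c u s v \<and> occurs s u' s' v' \<and> size s' < size s \<and> label s' = label s)"
    proof (rule Node.IH[OF c(1) _ _ c(2)])
      show "label s \<in> LAB" if "occurs c u s v" "root s = NT B" for u s v B
        using Node.prems(1) lift[OF that(1)] that(2) by blast
      show "valid P c" using Node.prems(2) c(1) by simp
    qed
    then show ?thesis
    proof (elim disjE exE conjE)
      fix u s v assume s: "occurs c u s v" "label s \<in> ?seen"
      then show ?thesis
      proof (cases "label s = label ?t")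
        case True
        obtain u' v' where "occurs ?t u' s v'" using lift[OF s(1)] by blast
        then have "occurs ?t [] ?t [] \<and> occurs ?t u' s v' \<and> size s < size ?t \<and> label s = label ?t"
          using smaller[OF s(1)] True occurs.here by simp
        then show ?thesis by (intro disjI2 exI)
      next
        case False
        obtain u' v' where "occurs ?t u' s v'" using lift[OF s(1)] by blast
        moreover have "label s \<in> seen" using s(2) False by simp
        ultimately have "occurs ?t u' s v' \<and> label s \<in> seen" ..
        then show ?thesis by (intro disjI1 exI)
      qed
    next
      fix u s v u' s' v'
      assume s: "occurs c u s v" "occurs s u' s' v'" "size s' < size s" "label s' = label s"
      from lift[OF s(1)] obtain p q where "occurs ?t p s q" by blast
      with s(2-4) have "occurs ?t p s q \<and> occurs s u' s' v' \<and> size s' < size s \<and> label s' = label s"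
        by simp
      then show ?thesis by (intro disjI2 exI)
    qed
  qed
qed

text \<open>Among the trees for \<open>w\<close> choose one of least size. If both pumped factors around a repeated label
  were empty, cutting out the part between the repetitions would give a smaller tree for the same
  word. The usual bound on the length of \<open>v @ x @ y\<close> is replaced here by control over its letters.\<close>

lemma content_pumping:
  assumes "context_free L"
  shows "\<exists>N. \<forall>w\<in>L. N < length w \<longrightarrow> (\<exists>u v x y t. w = u @ v @ x @ y @ t \<and> v @ y \<noteq> [] \<and>
    set v \<union> set y \<subseteq> set x \<and> u @ x @ t \<in> L \<and> u @ v @ v @ x @ y @ y @ t \<in> L)"
proof -
  from assms obtain P :: "(nat, 'a) prods" and S where
    P: "finite P" and L: "L = cfg_language P S" by (auto simp: context_free_def)
  define d where "d = Suc (Max (insert 0 ((length \<circ> snd) ` P)))"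
  have width: "length \<alpha> \<le> d" if "(A, \<alpha>) \<in> P" for A \<alpha>
  proof -
    have "length \<alpha> \<in> (length \<circ> snd) ` P" using that by force
    then show ?thesis unfolding d_def using P by (intro le_SucI Max_ge) auto
  qed
  have "0 < d" by (simp add: d_def)
  define LAB :: "((nat, 'a) symb \<times> 'a set) set"
    where "LAB = (NT ` fst ` P) \<times> Pow (terminals P)"
  have LAB: "finite LAB" unfolding LAB_def using P finite_terminals by blast
  have in_LAB: "label s \<in> LAB" if "valid P s" "root s = NT A" for s A
    using that yield_terminals[OF that] by (cases s) (force simp: label_def LAB_def)+
  show ?thesis
  proof (intro exI[of _ "d ^ card LAB"] ballI impI)
    fix w assume w: "w \<in> L" "d ^ card LAB < length w"
    let ?Q = "\<lambda>t. valid P t \<and> root t = NT S \<and> yield t = w"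
    obtain t0 where "?Q t0" using w(1) by (auto simp: L cfg_language_trees)
    from ex_has_least_nat[of ?Q, OF this, of size]
    obtain t where t: "valid P t" "root t = NT S" "yield t = w"
      and least: "\<And>t'. ?Q t' \<Longrightarrow> size t \<le> size t'" by blast
    have "\<exists>u s v u' s' v'. occurs t u s v \<and> occurs s u' s' v' \<and> size s' < size s \<and> label s' = label s"
    proof -
      have "label s \<in> LAB" if "occurs t u s v" "root s = NT A" for u s v A
        using in_LAB occurs_valid[OF that(1) t(1)] that(2) by blast
      from repeated_label[OF LAB this width \<open>0 < d\<close> t(1), where seen = "{}"] w(2) t(3)
      show ?thesis by simp
    qed
    then obtain u s z v s' y where s: "occurs t u s z" "occurs s v s' y" "size s' < size s"
      "label s' = label s" by blast
    let ?x = "yield s'"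
    note vs = occurs_valid[OF s(1) t(1)]
    note vs' = occurs_valid[OF s(2) vs]
    have root: "root s' = root s" and content: "set ?x = set (yield s)"
      using s(4) by (auto simp: label_def)
    have ys: "yield s = v @ ?x @ y" using occurs_yield[OF s(2)] .
    have yt: "w = u @ v @ ?x @ y @ z" using occurs_yield[OF s(1)] t(3) ys by simp
    have L_I: "yield t' \<in> L" if "valid P t'" "root t' = root t" for t'
      using that t(2) by (auto simp: L cfg_language_trees)
    obtain t0 where t0: "valid P t0" "root t0 = root t" "yield t0 = u @ ?x @ z"
      "size t0 + size s = size t + size s'"
      using replace_subtree[OF s(1) t(1) vs' root] .
    obtain s2 where s2: "valid P s2" "root s2 = root s" "yield s2 = v @ yield s @ y"
      using replace_subtree[OF s(2) vs vs root[symmetric]] .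
    obtain t2 where t2: "valid P t2" "root t2 = root t" "yield t2 = u @ yield s2 @ z"
      using replace_subtree[OF s(1) t(1) s2(1,2)] .
    have "v @ y \<noteq> []"
    proof
      assume "v @ y = []"
      then have "?Q t0" using t0 t yt by simp
      then show False using least[of t0] t0(4) s(3) by simp
    qed
    moreover have "set v \<union> set y \<subseteq> set ?x" using content ys by auto
    moreover have "u @ ?x @ z \<in> L" using L_I[OF t0(1,2)] t0(3) by simp
    moreover have "u @ v @ v @ ?x @ y @ y @ z \<in> L" using L_I[OF t2(1,2)] t2(3) s2(3) ys by simp
    ultimately show "\<exists>u v x y t. w = u @ v @ x @ y @ t \<and> v @ y \<noteq> [] \<and>
      set v \<union> set y \<subseteq> set x \<and> u @ x @ t \<in> L \<and> u @ v @ v @ x @ y @ y @ t \<in> L"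
      using yt by blast
  qed
qed

section \<open>Normal forms in the product of a free group and a cyclic group\<close>

definition gens :: "nat set" where "gens = {..4}"
definition edges :: "nat set set" where "edges = {{v, 4} | v. v < 4}"

abbreviation words :: "nat word set" where "words \<equiv> lists (letters gens)"
abbreviation same_element :: "(nat word \<times> nat word) set" where "same_element \<equiv> raag_rel gens edges"
abbreviation proj :: "nat word \<Rightarrow> nat word set" where "proj \<equiv> raag_proj gens edges"

fun inv_letter :: "nat letter \<Rightarrow> nat letter" where "inv_letter (v, b) = (v, \<not> b)"

lemma inv_letter_inv_letter [simp]: "inv_letter (inv_letter l) = l" by (cases l) auto
lemma fst_inv_letter [simp]: "fst (inv_letter l) = fst l" by (cases l) auto
lemma inv_letter_letters [simp]: "inv_letter l \<in> letters gens \<longleftrightarrow> l \<in> letters gens"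
  by (cases l) (auto simp: letters_def)

lemma inv_word_simps [simp]:
  "inv_word [] = []" "inv_word (l # w) = inv_word w @ [inv_letter l]"
  "inv_word (u @ w) = inv_word w @ inv_word u"
  "inv_word (inv_word w) = w"
proof -
  show "inv_word (l # w) = inv_word w @ [inv_letter l]" for l w by (cases l) (simp add: inv_word_def)
  show "inv_word (u @ w) = inv_word w @ inv_word u" by (simp add: inv_word_def)
  show "inv_word (inv_word w) = w"
    by (induction w) (auto simp: inv_word_def)
qed (simp add: inv_word_def)

lemma length_inv_word [simp]: "length (inv_word w) = length w"
  by (simp add: inv_word_def)

text \<open>Left multiplication of a freely reduced word by a letter; the central generator 4 acts trivially.
  That this respects the defining relations makes the free part of an element well defined.\<close>

definition push :: "nat letter \<Rightarrow> nat word \<Rightarrow> nat word" where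
  "push l s = (if fst l = 4 then s else if s \<noteq> [] \<and> hd s = inv_letter l then tl s else l # s)"

definition act :: "nat word \<Rightarrow> nat word \<Rightarrow> nat word" where
  "act w s = foldr push w s"

definition reduced :: "nat word \<Rightarrow> bool" where
  "reduced s \<longleftrightarrow> successively (\<lambda>x y. y \<noteq> inv_letter x) s \<and> (\<forall>l\<in>set s. fst l \<noteq> 4)"

lemma act_simps [simp]:
  "act [] s = s" "act (l # w) s = push l (act w s)" "act (u @ w) s = act u (act w s)"
  by (simp_all add: act_def)

lemma reduced_Nil [simp]: "reduced []" by (simp add: reduced_def)

lemma reduced_Cons: "reduced (l # s) \<longleftrightarrow> fst l \<noteq> 4 \<and> reduced s \<and> (s \<noteq> [] \<longrightarrow> hd s \<noteq> inv_letter l)"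
  by (auto simp: reduced_def successively_Cons)

lemma reduced_append:
  "reduced (u @ w) \<longleftrightarrow> reduced u \<and> reduced w \<and> (u \<noteq> [] \<and> w \<noteq> [] \<longrightarrow> hd w \<noteq> inv_letter (last u))"
  by (auto simp: reduced_def successively_append_iff)

lemma reduced_inv_word: "reduced w \<Longrightarrow> reduced (inv_word w)"
proof (induction w)
  case (Cons l w)
  have "last (inv_word w) = inv_letter (hd w)" if "w \<noteq> []" using that by (cases w) auto
  moreover have "inv_word w = [] \<longleftrightarrow> w = []" by (simp add: inv_word_def)
  ultimately show ?case using Cons by (auto simp: reduced_append reduced_Cons)
qed simp

lemma reduced_push: "reduced s \<Longrightarrow> reduced (push l s)"
  by (cases s) (auto simp: push_def reduced_Cons)

lemma reduced_act: "reduced s \<Longrightarrow> reduced (act w s)"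
  by (induction w) (auto simp: reduced_push)

lemma push_cancel: "reduced s \<Longrightarrow> push l (push (inv_letter l) s) = s"
  by (cases s) (auto simp: push_def reduced_Cons)

lemma act_inv_word [simp]:
  assumes "reduced s"
  shows "act w (act (inv_word w) s) = s" "act (inv_word w) (act w s) = s"
proof -
  have *: "act w (act (inv_word w) s) = s" if "reduced s" for w s
    using that by (induction w arbitrary: s) (auto simp: push_cancel reduced_push)
  show "act w (act (inv_word w) s) = s" using * assms .
  show "act (inv_word w) (act w s) = s" using *[of s "inv_word w"] assms by simp
qed

lemma act_reduced: "reduced w \<Longrightarrow> act w [] = w"
  by (induction w) (auto simp: reduced_Cons push_def)

definition free :: "nat word \<Rightarrow> nat word" where "free w = act w []"

lemma reduced_free: "reduced (free w)" by (simp add: free_def reduced_act)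
lemma free_reduced: "reduced w \<Longrightarrow> free w = w" by (simp add: free_def act_reduced)

text \<open>Exponent sums: the homomorphisms to the integers that extend a function on the generators.\<close>

fun weight :: "(nat \<Rightarrow> int) \<Rightarrow> nat word \<Rightarrow> int" where
  "weight f [] = 0"
| "weight f ((v, b) # w) = (if b then f v else - f v) + weight f w"

lemma weight_append [simp]: "weight f (u @ w) = weight f u + weight f w"
  by (induction f u rule: weight.induct) auto

lemma weight_Cons: "weight f (l # w) = weight f [l] + weight f w"
  by (cases l) simp

lemma weight_inv_letter [simp]: "weight f [inv_letter l] = - weight f [l]"
  by (cases l) simp

lemma weight_inv_word [simp]: "weight f (inv_word w) = - weight f w"
proof (induction w)
  case (Cons l w)
  then show ?case by (cases l) simp
qed simp

definition centre_exp :: "nat word \<Rightarrow> int" where "centre_exp = weight (\<lambda>v. if v = 4 then 1 else 0)"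

definition charge :: "nat \<Rightarrow> int" where
  "charge v = (if v < 4 then (if even v then 1 else - 1) else 0)"

definition slope :: "nat word \<Rightarrow> int" where "slope = weight charge"

definition zpow :: "int \<Rightarrow> nat word" where
  "zpow k = replicate (nat \<bar>k\<bar>) (4, 0 \<le> k)"

lemma same_element_weight: "(u, w) \<in> same_element \<Longrightarrow> weight f u = weight f w"
  by (induction rule: raag_rel.induct) auto

lemma edgesD: "{s, t} \<in> edges \<Longrightarrow> s = 4 \<or> t = 4"
  by (auto simp: edges_def doubleton_eq_iff)

lemma same_element_act:
  "(u, w) \<in> same_element \<Longrightarrow> reduced s \<Longrightarrow> act u s = act w s"
proof (induction arbitrary: s rule: raag_rel.induct)
  case (cancel v u w b)
  then show ?case using push_cancel[of "act w s" "(v, b)"] by (simp add: reduced_act)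
next
  case (commute x y u w)
  then show ?case using edgesD[of x y] by (auto simp: push_def)
qed auto

lemma zpow_words [simp]: "zpow k \<in> words"
  by (auto simp: zpow_def letters_def gens_def)

lemma act_central: "\<forall>l\<in>set w. fst l = 4 \<Longrightarrow> act w s = s"
  by (induction w) (auto simp: push_def)

lemma act_zpow [simp]: "act (zpow k) s = s"
  by (rule act_central) (auto simp: zpow_def)

lemma weight_replicate [simp]: "weight f (replicate n (v, b)) = int n * (if b then f v else - f v)"
  by (induction n) (auto simp: algebra_simps)

lemma centre_exp_zpow [simp]: "centre_exp (zpow k) = k"
  by (simp add: zpow_def centre_exp_def)

lemma length_zpow [simp]: "length (zpow k) = nat \<bar>k\<bar>" by (simp add: zpow_def)

lemma act_words: "w \<in> words \<Longrightarrow> s \<in> words \<Longrightarrow> act w s \<in> words"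
proof (induction w)
  case (Cons l w)
  then have "act w s \<in> words" "l \<in> letters gens" by auto
  then show ?case by (auto simp: push_def dest: list.set_sel(2))
qed simp

lemma free_words: "w \<in> words \<Longrightarrow> free w \<in> words"
  by (simp add: free_def act_words)

lemma letter_cancel:
  assumes "l \<in> letters gens" "u \<in> words" "w \<in> words"
  shows "(u @ [l, inv_letter l] @ w, u @ w) \<in> same_element"
  using raag_rel.cancel[of "fst l" gens u w "snd l" edges] assms
  by (cases l) (auto simp: letters_def)

text \<open>The presentation states commutation for positive letters only; the cases with inverses follow
  because \<open>y x = x y\<close> implies \<open>x y\<^sup>-\<^sup>1 = y\<^sup>-\<^sup>1 x\<close>.\<close>

lemma central_commute:
  assumes "l \<in> letters gens"
  shows "([(4, b), l], [l, (4, b)]) \<in> same_element"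
proof -
  obtain v c where l: "l = (v, c)" "v \<le> 4" using assms by (cases l) (auto simp: letters_def gens_def)
  have swap_inv: "([x, inv_letter y], [inv_letter y, x]) \<in> same_element"
    if "([y, x], [x, y]) \<in> same_element" "x \<in> letters gens" "y \<in> letters gens" for x y
  proof -
    have "([inv_letter y] @ [y, x] @ [inv_letter y], [inv_letter y] @ [x, y] @ [inv_letter y]) \<in> same_element"
      by (intro raag_rel_append that(1) raag_rel.refl) (use that in auto)
    moreover have "([inv_letter y, y] @ [x, inv_letter y], [x, inv_letter y]) \<in> same_element"
      using letter_cancel[of "inv_letter y" "[]" "[x, inv_letter y]"] that by simp
    moreover have "([inv_letter y, x] @ [y, inv_letter y], [inv_letter y, x]) \<in> same_element"
      using letter_cancel[of y "[inv_letter y, x]" "[]"] that by simp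
    ultimately show ?thesis by (simp) (meson raag_rel.sym raag_rel.trans)
  qed
  show ?thesis
  proof (cases "v = 4")
    case True
    then show ?thesis
    proof (cases "b = c")
      case True
      then show ?thesis using l \<open>v = 4\<close> assms by (auto intro!: raag_rel.refl simp: letters_def)
    next
      case False
      then have "(4, b) = inv_letter l" using l \<open>v = 4\<close> by auto
      moreover have "([inv_letter l, l], []) \<in> same_element" "([l, inv_letter l], []) \<in> same_element"
        using letter_cancel[of l "[]" "[]"] letter_cancel[of "inv_letter l" "[]" "[]"] assms by simp_all
      ultimately show ?thesis using raag_rel.trans raag_rel.sym by metis
    qed
  next
    case False
    then have v: "v < 4" using l by simp
    have L: "(v, x) \<in> letters gens" "(4, x) \<in> letters gens" for x
      using v by (auto simp: letters_def gens_def)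
    have 1: "([(v, True), (4, True)], [(4, True), (v, True)]) \<in> same_element"
      using raag_rel.commute[of v gens 4 edges "[]" "[]"] v by (auto simp: gens_def edges_def)
    have 2: "([(4, True), (v, False)], [(v, False), (4, True)]) \<in> same_element"
      using swap_inv[OF 1 L(2) L(1)] by simp
    have 3: "([(v, c), (4, False)], [(4, False), (v, c)]) \<in> same_element" for c
      using swap_inv[OF raag_rel.sym[OF 1] L(1) L(2)] swap_inv[OF 2 L(1) L(2)] by (cases c) auto
    show ?thesis using 1 2 3[of c] l(1) by (cases b; cases c) (auto intro: raag_rel.sym)
  qed
qed

lemma central_commute_word:
  "w \<in> words \<Longrightarrow> ((4, b) # w, w @ [(4, b)]) \<in> same_element"
proof (induction w)
  case Nil
  then show ?case by (auto intro!: raag_rel.refl simp: letters_def gens_def)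
next
  case (Cons l w)
  have "([(4, b), l] @ w, [l, (4, b)] @ w) \<in> same_element"
    by (intro raag_rel_append_right central_commute) (use Cons.prems in auto)
  moreover have "([l] @ (4, b) # w, [l] @ w @ [(4, b)]) \<in> same_element"
    by (intro raag_rel_append_left) (use Cons in auto)
  ultimately show ?case by (simp) (meson raag_rel.trans)
qed

lemma zpow_int: "zpow (int n) = replicate n (4, True)" "zpow (- int n) = replicate n (4, False)"
  by (auto simp: zpow_def)

lemma central_zpow: "((4, b) # zpow k, zpow (k + (if b then 1 else - 1))) \<in> same_element"
proof -
  have pos: "(4, True) # zpow (int n) = zpow (int n + 1)" for n
    using zpow_int(1)[of "Suc n"] zpow_int(1)[of n] by (simp add: add.commute)
  have neg: "(4, False) # zpow (- int n) = zpow (- int n - 1)" for n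
  proof -
    have "- int n - 1 = - int (Suc n)" by simp
    then show ?thesis using zpow_int(2)[of "Suc n"] zpow_int(2)[of n] by (simp only: replicate_Suc)
  qed
  have 4: "(4, c) \<in> letters gens" for c by (simp add: letters_def gens_def)
  have refl: "(zpow k, zpow k) \<in> same_element" for k by (rule raag_rel.refl) (rule zpow_words)
  \<comment> \<open>In the first two cases the letter extends the power, in the last two it cancels against it.\<close>
  consider n where "b" "k = int n" | n where "\<not> b" "k = - int n"
    | n where "b" "k = - int n - 1" | n where "\<not> b" "k = int n + 1"
  proof -
    have "k = int (nat k) \<or> k = - int (nat (- k - 1)) - 1" "k = - int (nat (- k)) \<or> k = int (nat (k - 1)) + 1"
      by linarith+
    then show ?thesis using that by (cases b) metis+
  qed
  then show ?thesis
  proof cases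
    case 1
    then show ?thesis using pos refl by simp
  next
    case 2
    then show ?thesis using neg refl by simp
  next
    case (3 n)
    have "((4, True) # zpow (- int n - 1), zpow (- int n)) \<in> same_element"
      unfolding neg[symmetric] using letter_cancel[OF 4[of True], of "[]" "zpow (- int n)"] by simp
    then show ?thesis using 3 by simp
  next
    case (4 n)
    have "((4, False) # zpow (int n + 1), zpow (int n)) \<in> same_element"
      unfolding pos[symmetric] 
      using letter_cancel[OF \<open>\<And>c. (4, c) \<in> letters gens\<close>[of False], of "[]" "zpow (int n)"]
      by simp
    then show ?thesis using 4 by simp
  qed
qed

lemma same_element_normal_form:
  "w \<in> words \<Longrightarrow> (w, free w @ zpow (centre_exp w)) \<in> same_element"
proof (induction w)
  case Nil
  then show ?case by (auto intro!: raag_rel.refl simp: free_def centre_exp_def zpow_def)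
next
  case (Cons l w)
  obtain v b where l: "l = (v, b)" by (cases l)
  have w: "w \<in> words" "free w \<in> words" and l': "l \<in> letters gens"
    using Cons.prems free_words by auto
  have "(l # w, l # free w @ zpow (centre_exp w)) \<in> same_element"
    using raag_rel_append_left[OF Cons.IH[OF w(1)], of "[l]"] l' by simp
  moreover have "(l # free w @ zpow (centre_exp w), free (l # w) @ zpow (centre_exp (l # w))) \<in> same_element"
  proof (cases "v = 4")
    case True
    have "((l # free w) @ zpow (centre_exp w), (free w @ [l]) @ zpow (centre_exp w)) \<in> same_element"
      unfolding l True by (intro raag_rel_append_right central_commute_word w(2) zpow_words)
    moreover have "(free w @ l # zpow (centre_exp w), free w @ zpow (centre_exp (l # w))) \<in> same_element"
      using raag_rel_append_left[OF central_zpow[of b "centre_exp w"] w(2)]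
      by (cases b) (simp_all add: l True centre_exp_def add.commute)
    ultimately show ?thesis using True l
      by (simp add: free_def push_def) (meson raag_rel.trans)
  next
    case False
    have z: "centre_exp (l # w) = centre_exp w" using False l by (simp add: centre_exp_def)
    show ?thesis
    proof (cases "free w \<noteq> [] \<and> hd (free w) = inv_letter l")
      case True
      then have f: "free w = inv_letter l # free (l # w)" using False l by (cases "free w") (auto simp: free_def push_def)
      show ?thesis unfolding z
        using letter_cancel[OF l', of "[]" "free (l # w) @ zpow (centre_exp w)"] w(2) f by auto
    next
      case f: False
      then have "free (l # w) = l # free w" using False l by (auto simp: free_def push_def)
      moreover have "(l # free w @ zpow (centre_exp w), l # free w @ zpow (centre_exp w)) \<in> same_element"
        by (rule raag_rel.refl) (use w(2) l' in simp)
      ultimately show ?thesis by (simp only: z append_Cons)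
    qed
  qed
  ultimately show ?case by (rule raag_rel.trans)
qed

text \<open>The free part and the central exponent are invariants by the action on reduced words and by
  exponent sums, and they are complete because each word can be brought to the normal form made of
  them. All later statements about group elements are reduced to these two invariants.\<close>

lemma same_element_iff:
  assumes "u \<in> words" "w \<in> words"
  shows "(u, w) \<in> same_element \<longleftrightarrow> free u = free w \<and> centre_exp u = centre_exp w"
proof
  assume "(u, w) \<in> same_element"
  then show "free u = free w \<and> centre_exp u = centre_exp w"
    using same_element_act[of u w "[]"] same_element_weight[of u w] by (simp add: free_def centre_exp_def)
next
  assume "free u = free w \<and> centre_exp u = centre_exp w"
  then show "(u, w) \<in> same_element"
    using same_element_normal_form[OF assms(1)] same_element_normal_form[OF assms(2)]
    by simp (meson raag_rel.sym raag_rel.trans)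
qed

lemma length_lower_bound: "int (length (free w)) + \<bar>centre_exp w\<bar> \<le> int (length w)"
proof (induction w)
  case (Cons l w)
  have "length (free (l # w)) \<le> length (free w) + (if fst l = 4 then 0 else 1)"
    by (cases "free w") (auto simp: free_def push_def)
  moreover have "\<bar>centre_exp (l # w)\<bar> \<le> \<bar>centre_exp w\<bar> + (if fst l = 4 then 1 else 0)"
    by (cases l) (auto simp: centre_exp_def)
  ultimately show ?case using Cons.IH by (auto split: if_splits)
qed (simp add: free_def centre_exp_def)

section \<open>The twisting automorphism\<close>

definition partner :: "nat \<Rightarrow> nat" where
  "partner v = (if v < 4 then (if even v then v + 1 else v - 1) else v)"

lemma less_4_cases: "v < 4 \<Longrightarrow> v = 0 \<or> v = 1 \<or> v = 2 \<or> v = (3 :: nat)" by linarith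

lemma partner_simps [simp]:
  "partner (partner v) = v" "partner v = 4 \<longleftrightarrow> v = 4" "partner v \<le> 4 \<longleftrightarrow> v \<le> 4"
  "charge (partner v) = - charge v" "charge 4 = 0"
  by (cases "v < 4"; auto simp: partner_def charge_def dest!: less_4_cases)+

definition mirror_letter :: "nat letter \<Rightarrow> nat letter" where "mirror_letter l = (partner (fst l), snd l)"

lemma mirror_letter_simps [simp]:
  "mirror_letter (mirror_letter l) = l" "inv_letter (mirror_letter l) = mirror_letter (inv_letter l)"
  "fst (mirror_letter l) = partner (fst l)" "snd (mirror_letter l) = snd l"
  "slope [mirror_letter l] = - slope [l]" "centre_exp [mirror_letter l] = centre_exp [l]"
  by (cases l; auto simp: mirror_letter_def slope_def centre_exp_def)+

lemma mirror_letter_inject [simp]: "mirror_letter l = mirror_letter l' \<longleftrightarrow> l = l'" by (metis mirror_letter_simps(1))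

abbreviation mirror :: "nat word \<Rightarrow> nat word" where "mirror \<equiv> map mirror_letter"

lemma slope_simps [simp]:
  "slope [] = 0" "slope (u @ w) = slope u + slope w" "slope (inv_word w) = - slope w"
  "slope (zpow k) = 0" "slope [inv_letter l] = - slope [l]"
  by (simp_all add: slope_def zpow_def)

lemma centre_exp_simps [simp]:
  "centre_exp [] = 0" "centre_exp (u @ w) = centre_exp u + centre_exp w" "centre_exp (inv_word w) = - centre_exp w"
  by (simp_all add: centre_exp_def)

lemma slope_Cons: "slope (l # w) = slope [l] + slope w"
  unfolding slope_def by (rule weight_Cons)

lemma centre_exp_Cons: "centre_exp (l # w) = centre_exp [l] + centre_exp w"
  unfolding centre_exp_def by (rule weight_Cons)

lemma slope_mirror [simp]: "slope (mirror w) = - slope w"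
proof (induction w)
  case (Cons l w)
  then show ?case using slope_Cons[of l w] slope_Cons[of "mirror_letter l" "mirror w"] by simp
qed simp

lemma mirror_words [simp]: "mirror w \<in> words \<longleftrightarrow> w \<in> words"
proof -
  have "mirror_letter l \<in> letters gens \<longleftrightarrow> l \<in> letters gens" for l
    by (cases l) (simp add: mirror_letter_def letters_def gens_def)
  then show ?thesis by (induction w) simp_all
qed

lemma mirror_letter_comp [simp]: "mirror_letter \<circ> mirror_letter = id" by (simp add: fun_eq_iff)

lemma inv_word_mirror: "inv_word (mirror w) = mirror (inv_word w)"
  by (induction w) auto

lemma push_mirror_letter: "push (mirror_letter l) (mirror s) = mirror (push l s)"
  by (cases s) (auto simp: push_def)

lemma act_mirror: "act (mirror w) (mirror s) = mirror (act w s)"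
  by (induction w) (auto simp: push_mirror_letter)

text \<open>The automorphism on words. An inverse letter is sent to \<open>\<sigma>(x)\<^sup>-\<^sup>1 z\<^sup>-\<^sup>1\<close> or \<open>\<sigma>(x)\<^sup>-\<^sup>1 z\<close>, which is
  the inverse of the image of the letter only up to order; as \<open>z\<close> is central, the element is the
  same.\<close>

definition twist :: "nat word \<Rightarrow> nat word" where
  "twist w = concat (map (\<lambda>l. mirror_letter l # zpow (slope [l])) w)"

lemma twist_append [simp]: "twist (u @ w) = twist u @ twist w" by (simp add: twist_def)

lemma twist_words: "w \<in> words \<Longrightarrow> twist w \<in> words"
proof (induction w)
  case (Cons l w)
  then have "[mirror_letter l] @ zpow (slope [l]) @ twist w \<in> words"
    using mirror_words[of "[l]"] by (simp only: append_in_lists_conv zpow_words) simp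
  then show ?case by (simp add: twist_def)
qed (simp add: twist_def)

lemma act_twist [simp]: "act (twist w) s = act (mirror w) s"
  by (induction w) (auto simp: twist_def)

lemma free_twist [simp]: "free (twist w) = mirror (free w)"
  using act_mirror[of w "[]"] by (simp add: free_def)

lemma centre_exp_twist [simp]: "centre_exp (twist w) = centre_exp w + slope w"
proof (induction w)
  case (Cons l w)
  have "twist (l # w) = [mirror_letter l] @ zpow (slope [l]) @ twist w" by (simp add: twist_def)
  then show ?case
    using centre_exp_Cons[of l w] centre_exp_Cons[of "mirror_letter l" "zpow (slope [l]) @ twist w"]
      slope_Cons[of l w] Cons.IH
    by simp
qed (simp add: twist_def)

lemma slope_twist [simp]: "slope (twist w) = - slope w"
proof (induction w)
  case (Cons l w)
  have "twist (l # w) = [mirror_letter l] @ zpow (slope [l]) @ twist w" by (simp add: twist_def)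
  then show ?case
    using slope_Cons[of l w] slope_Cons[of "mirror_letter l" "zpow (slope [l]) @ twist w"] Cons.IH by simp
qed (simp add: twist_def)

abbreviation G :: "nat word set monoid" where "G \<equiv> raag gens edges"

lemma proj_eq_iff:
  assumes "u \<in> words" "w \<in> words"
  shows "proj u = proj w \<longleftrightarrow> free u = free w \<and> centre_exp u = centre_exp w"
  using raag_proj_eq_iff[OF assms] same_element_iff[OF assms] by blast

lemma inv_proj: "w \<in> words \<Longrightarrow> inv\<^bsub>G\<^esub> (proj w) = proj (inv_word w)"
  by (rule group.inv_equality[OF group_raag])
    (auto simp: raag_mult inv_word_closed raag_proj_closed raag_one proj_eq_iff free_def
     )

lemma raag_length_proj:
  assumes "w \<in> words"
  shows "int (raag_length gens edges (proj w)) = int (length (free w)) + \<bar>centre_exp w\<bar>"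
proof -
  let ?u = "free w @ zpow (centre_exp w)"
  have u: "?u \<in> words" using free_words[OF assms] by simp
  have "proj ?u = proj w"
    using same_element_normal_form[OF assms] raag_proj_eq_iff[OF assms u, of edges] by simp
  moreover have "length ?u \<le> length u'" if "u' \<in> words" "proj u' = proj w" for u'
    using length_lower_bound[of u'] proj_eq_iff[OF that(1) assms] that(2) by simp
  ultimately have "raag_length gens edges (proj w) = length ?u"
    unfolding raag_length_def
    by (intro Least_equality bexI[of _ ?u] conjI u) auto
  then show ?thesis by simp
qed

text \<open>The words in one class have equivalent images, so the union is that of a single class; see the
  lemma \<open>twist_aut_proj\<close>. The restriction to the carrier makes the function extensional, which
  membership in \<^const>\<open>auto\<close> requires.\<close>

definition twist_aut :: "nat word set \<Rightarrow> nat word set" where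
  "twist_aut = (\<lambda>C\<in>carrier G. \<Union>w\<in>C. proj (twist w))"

lemma twist_aut_proj:
  assumes "w \<in> words"
  shows "twist_aut (proj w) = proj (twist w)"
proof -
  have "proj (twist u) = proj (twist w)" if "u \<in> proj w" for u
  proof -
    have r: "(w, u) \<in> same_element" using that by (simp add: raag_proj_def)
    then have u: "u \<in> words" using raag_rel_words by blast
    have "slope w = slope u" using same_element_weight[OF r] by (simp add: slope_def)
    then show ?thesis
      using r same_element_iff[OF assms u] by (simp add: proj_eq_iff twist_words u assms)
  qed
  moreover have "w \<in> proj w" using assms by (auto simp: raag_proj_def intro: raag_rel.refl)
  ultimately have "(\<Union>u\<in>proj w. proj (twist u)) = proj (twist w)" by blast
  then show ?thesis using raag_proj_closed[OF assms, of edges] by (simp add: twist_aut_def)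
qed

lemma twist_aut_closed: "g \<in> carrier G \<Longrightarrow> twist_aut g \<in> carrier G"
  unfolding carrier_raag
proof (erule imageE)
  fix w assume "w \<in> words" "g = proj w"
  then show "twist_aut g \<in> proj ` words" by (simp add: twist_aut_proj twist_words)
qed

lemma twist_aut_twist_aut: "g \<in> carrier G \<Longrightarrow> twist_aut (twist_aut g) = g"
  unfolding carrier_raag
proof (erule imageE)
  fix w assume "w \<in> words" "g = proj w"
  then show "twist_aut (twist_aut g) = g" by (simp add: twist_aut_proj twist_words proj_eq_iff)
qed

lemma twist_aut_auto: "twist_aut \<in> auto G"
proof -
  have "twist_aut \<in> hom G G"
  proof (rule homI)
    fix g h assume "g \<in> carrier G" "h \<in> carrier G"
    then obtain u w where "u \<in> words" "w \<in> words" "g = proj u" "h = proj w"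
      unfolding carrier_raag by blast
    then show "twist_aut (g \<otimes>\<^bsub>G\<^esub> h) = twist_aut g \<otimes>\<^bsub>G\<^esub> twist_aut h"
      by (simp add: raag_mult twist_aut_proj twist_words)
  qed (rule twist_aut_closed)
  moreover have "bij_betw twist_aut (carrier G) (carrier G)"
    by (rule bij_betw_byWitness[where f' = twist_aut]) (auto simp: twist_aut_twist_aut twist_aut_closed)
  moreover have "twist_aut \<in> extensional (carrier G)" by (simp add: twist_aut_def)
  ultimately show ?thesis by (simp add: auto_def Bij_def)
qed

lemma twist_aut_not_length_preserving: "\<not> length_preserving gens edges twist_aut"
proof
  let ?a = "[(0, True)] :: nat word"
  have a: "?a \<in> words" by (simp add: letters_def gens_def)
  assume "length_preserving gens edges twist_aut"
  then have "raag_length gens edges (proj (twist ?a)) = raag_length gens edges (proj ?a)"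
    using raag_proj_closed[OF a, of edges] twist_aut_proj[OF a] unfolding length_preserving_def by metis
  then have "\<bar>centre_exp ?a + slope ?a\<bar> = \<bar>centre_exp ?a\<bar>"
    using raag_length_proj[OF a] raag_length_proj[OF twist_words[OF a]] by simp
  then show False by (simp add: centre_exp_def slope_def charge_def)
qed

text \<open>Conjugating by \<open>x\<close> changes the central exponent by minus the slope of \<open>x\<close>: the central letters of \<open>x\<close>
  cancel against those of its image, and only those that the automorphism has added survive.\<close>

lemma ConjGeo_iff:
  "w \<in> ConjGeo gens edges twist_aut \<longleftrightarrow> w \<in> words \<and>
    (\<forall>x\<in>words. int (length w) \<le> int (length (free (inv_word (twist x) @ w @ x))) + \<bar>centre_exp w - slope x\<bar>)"
proof (cases "w \<in> words")
  case w: True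
  let ?c = "\<lambda>x. inv_word (twist x) @ w @ x"
  have c: "?c x \<in> words" if "x \<in> words" for x
    using that w twist_words inv_word_closed append_in_lists_conv by metis
  have conj: "twisted_conj G twist_aut h (proj w) \<longleftrightarrow> (\<exists>x\<in>words. h = proj (?c x))" for h
  proof -
    have e: "inv\<^bsub>G\<^esub> (twist_aut (proj x)) \<otimes>\<^bsub>G\<^esub> proj w \<otimes>\<^bsub>G\<^esub> proj x = proj (?c x)" if x: "x \<in> words" for x
      using x w twist_words[OF x] inv_word_closed[OF twist_words[OF x]]
      by (simp add: twist_aut_proj inv_proj raag_mult)
    show ?thesis
    proof
      assume "twisted_conj G twist_aut h (proj w)"
      then show "\<exists>x\<in>words. h = proj (?c x)"
        unfolding twisted_conj_def carrier_raag using e by blast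
    next
      assume "\<exists>x\<in>words. h = proj (?c x)"
      then obtain x where x: "x \<in> words" "h = proj (?c x)" by blast
      then show "twisted_conj G twist_aut h (proj w)"
        unfolding twisted_conj_def
        using e[OF x(1)] raag_proj_closed[OF c[OF x(1)]] raag_proj_closed[OF w] raag_proj_closed[OF x(1)]
        by metis
    qed
  qed
  let ?l = "\<lambda>x. raag_length gens edges (proj (?c x))"
  have len: "int (?l x) = int (length (free (?c x))) + \<bar>centre_exp w - slope x\<bar>" if "x \<in> words" for x
    using raag_length_proj[OF c[OF that]] by simp
  have one: "?l [] \<le> length w"
    using raag_length_proj[OF w] length_lower_bound[of w] by (simp add: twist_def)
  have least: "(LEAST n. \<exists>h. twisted_conj G twist_aut h (proj w) \<and> raag_length gens edges h = n)
    = (LEAST n. \<exists>x\<in>words. ?l x = n)"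
    unfolding conj by (rule arg_cong[of _ _ Least]) auto
  have "length w = (LEAST n. \<exists>x\<in>words. ?l x = n) \<longleftrightarrow> (\<forall>x\<in>words. length w \<le> ?l x)"
  proof
    assume "length w = (LEAST n. \<exists>x\<in>words. ?l x = n)"
    then show "\<forall>x\<in>words. length w \<le> ?l x" by (metis (mono_tags, lifting) Least_le)
  next
    assume le: "\<forall>x\<in>words. length w \<le> ?l x"
    have "?l [] = length w" using bspec[OF le, of "[]"] one by simp
    then have "\<exists>x\<in>words. ?l x = length w" by (intro bexI[of _ "[]"]) simp_all
    then show "length w = (LEAST n. \<exists>x\<in>words. ?l x = n)"
      using le by (intro Least_equality[symmetric]) blast+
  qed
  also have "\<dots> \<longleftrightarrow> (\<forall>x\<in>words. int (length w) \<le> int (length (free (?c x))) + \<bar>centre_exp w - slope x\<bar>)"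
    using len by (metis of_nat_le_iff)
  finally show ?thesis using w by (simp add: ConjGeo_def least)
qed (simp add: ConjGeo_def)

lemma act_push: "reduced t \<Longrightarrow> reduced s \<Longrightarrow> act (push l t) s = push l (act t s)"
proof (cases "fst l \<noteq> 4 \<and> t \<noteq> [] \<and> hd t = inv_letter l")
  case True
  assume r: "reduced t" "reduced s"
  from True obtain t' where t: "t = inv_letter l # t'" by (cases t) auto
  then have "push l t = t'" using True by (simp add: push_def)
  then show ?thesis using push_cancel[of "act t' s" l] r by (simp add: t reduced_act)
next
  case False
  then show ?thesis by (auto simp: push_def)
qed

lemma act_free: "reduced s \<Longrightarrow> act (free w) s = act w s"
proof (induction w)
  case (Cons l w)
  have "free (l # w) = push l (free w)" by (simp add: free_def)
  then show ?case using act_push[OF reduced_free Cons.prems] Cons by simp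
qed (simp add: free_def)

lemma act_inv_twist:
  assumes "reduced s"
  shows "act (inv_word (twist x)) s = act (inv_word (mirror (free x))) s"
proof -
  define t where "t = act (inv_word (mirror (free x))) s"
  have t: "reduced t" using assms by (simp add: t_def reduced_act)
  have "act (twist x) t = act (mirror (free x)) t"
    using act_free[OF t, of "twist x"] by simp
  also have "\<dots> = s" using assms by (simp only: t_def act_inv_word)
  finally have "s = act (twist x) t" ..
  then show ?thesis using t by (metis act_inv_word(2) t_def)
qed

text \<open>The slope ignores the central generator.\<close>

lemma slope_free: "w \<in> words \<Longrightarrow> slope (free w) = slope w"
  using same_element_weight[OF same_element_normal_form, of w charge]
  by (simp add: slope_def zpow_def charge_def)

text \<open>Hence only freely reduced conjugators without central letters need to be considered.\<close>

lemma free_twisted_conj: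
  "free (inv_word (twist x) @ w @ x) = free (inv_word (mirror (free x)) @ free w @ free x)"
proof -
  have "reduced (act w (act x []))" by (simp add: reduced_act)
  then have "act (inv_word (twist x)) (act w (act x []))
      = act (inv_word (mirror (free x))) (act (free w) (act (free x) []))"
    by (simp add: act_inv_twist act_free reduced_act)
  then show ?thesis by (simp add: free_def)
qed

section \<open>A lower bound on twisted conjugacy classes\<close>

text \<open>The pair \<open>(g, n)\<close> stands for the element \<open>g z\<^sup>n\<close>. The prefixes \<open>p\<close> and the suffixes \<open>q\<close> are exactly
  what a twisted rotation can move to the other end, and \<open>n\<close> plus their slope is the central
  exponent afterwards. The property says that this exponent stays positive. It is symmetric in
  prefixes and suffixes, and it is therefore inherited by the rotated pairs.\<close>

definition balanced :: "nat word \<Rightarrow> int \<Rightarrow> bool" where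
  "balanced g n \<longleftrightarrow> g \<noteq> [] \<and> (\<forall>l\<in>set g. snd l \<and> fst l \<noteq> 4) \<and>
     (\<forall>p q. g = p @ q \<longrightarrow> 1 \<le> n + slope p \<and> 1 \<le> n + slope q)"

lemma balanced_rotate:
  assumes "balanced (mirror_letter y # g) n"
  shows "balanced (g @ [y]) (n - slope [y])"
proof -
  have split: "1 \<le> n + slope p \<and> 1 \<le> n + slope q" if "mirror_letter y # g = p @ q" for p q
    using that assms by (simp add: balanced_def)
  have "1 \<le> n - slope [y] + slope p \<and> 1 \<le> n - slope [y] + slope q" if e: "g @ [y] = p @ q" for p q
  proof (cases q rule: rev_cases)
    case Nil
    then have p: "p = g @ [y]" using e by simp
    show ?thesis using split[of "mirror_letter y # g" "[]"] split[of "[mirror_letter y]" g]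
      unfolding p Nil by (simp add: slope_Cons[of "mirror_letter y" g])
  next
    case (snoc q' l)
    then have "g = p @ q'" "l = y" using e by auto
    then show ?thesis using snoc split[of "mirror_letter y # p" q'] by (simp add: slope_Cons[of "mirror_letter y" p])
  qed
  moreover have "\<forall>l\<in>set (g @ [y]). snd l \<and> fst l \<noteq> 4"
    using assms by (auto simp: balanced_def)
  ultimately show ?thesis by (simp add: balanced_def)
qed

lemma balanced_rotate_back:
  assumes "balanced (g @ [inv_letter y]) n"
  shows "balanced (inv_letter (mirror_letter y) # g) (n - slope [y])"
proof -
  have split: "1 \<le> n + slope p \<and> 1 \<le> n + slope q" if "g @ [inv_letter y] = p @ q" for p q
    using that assms by (simp add: balanced_def)
  have "1 \<le> n - slope [y] + slope p \<and> 1 \<le> n - slope [y] + slope q"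
    if e: "inv_letter (mirror_letter y) # g = p @ q" for p q
  proof (cases p)
    case Nil
    then have q: "q = inv_letter (mirror_letter y) # g" using e by simp
    show ?thesis using split[of "[]" "g @ [inv_letter y]"] split[of g "[inv_letter y]"]
      unfolding q Nil by (simp add: slope_Cons[of _ g])
  next
    case (Cons l p')
    then have "g = p' @ q" "l = inv_letter (mirror_letter y)" using e by auto
    then show ?thesis using Cons split[of p' "q @ [inv_letter y]"] by (simp add: slope_Cons[of _ p'])
  qed
  moreover have "\<forall>l\<in>set (inv_letter (mirror_letter y) # g). snd l \<and> fst l \<noteq> 4"
    using assms by (cases y) (auto simp: balanced_def mirror_letter_def)
  ultimately show ?thesis by (simp add: balanced_def)
qed

lemma reduced_positive: "\<forall>l\<in>set g. snd l \<and> fst l \<noteq> 4 \<Longrightarrow> reduced g"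
proof (induction g)
  case (Cons l g)
  then show ?case by (cases g; cases l) (auto simp: reduced_Cons)
qed simp

lemma reduced_mirror: "reduced s \<Longrightarrow> reduced (mirror s)"
proof (induction s)
  case (Cons l s)
  then show ?case by (cases s) (auto simp: reduced_Cons)
qed simp

lemma slope_bound: "\<bar>slope w\<bar> \<le> int (length w)"
proof (induction w)
  case (Cons l w)
  have "\<bar>slope [l]\<bar> \<le> 1" by (cases l) (simp add: slope_def charge_def)
  then show ?case using Cons slope_Cons[of l w] by simp
qed simp

text \<open>Induction on the conjugator. If its first letter cancels against the first or the last letter of
  \<open>g\<close>, then conjugating by that letter only rotates \<open>g\<close>, and the rotated pair is again balanced. It
  cannot cancel at both ends, since \<open>g\<close> is positive. If it cancels at neither end, then nothing
  cancels at all: the free part grows by twice the length of the conjugator, while the central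
  exponent drops by at most that length.\<close>

lemma balanced_bound:
  assumes "balanced g n" "reduced s"
  shows "int (length g) + 1 \<le> int (length (free (inv_word (mirror s) @ g @ s))) + \<bar>n - slope s\<bar>"
  using assms
proof (induction s arbitrary: g n)
  case Nil
  have "1 \<le> n + slope []" using Nil.prems(1) unfolding balanced_def by blast
  moreover have "free g = g"
    using Nil.prems(1) by (intro free_reduced reduced_positive) (simp add: balanced_def)
  ultimately show ?case by simp
next
  case (Cons y s)
  have g: "g \<noteq> []" "reduced g" "\<And>l. l \<in> set g \<Longrightarrow> snd l" "1 \<le> n"
    using Cons.prems(1) reduced_positive[of g] unfolding balanced_def by (auto dest: spec[of _ "[]"])
  have s: "reduced s" "fst y \<noteq> 4" using Cons.prems(2) by (auto simp: reduced_Cons)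
  consider "hd g = mirror_letter y" | "last g = inv_letter y" | "hd g \<noteq> mirror_letter y" "last g \<noteq> inv_letter y" by blast
  then show ?case
  proof cases
    case 1
    then obtain g' where g': "g = mirror_letter y # g'" using g(1) by (cases g) auto
    have "push (inv_letter (mirror_letter y)) (push (mirror_letter y) (act g' (push y (act s []))))
        = act g' (push y (act s []))"
      using push_cancel[of _ "inv_letter (mirror_letter y)"] by (simp add: reduced_act reduced_push)
    then have "free (inv_word (mirror (y # s)) @ g @ y # s) = free (inv_word (mirror s) @ (g' @ [y]) @ s)"
      by (simp add: free_def g')
    moreover have "int (length (g' @ [y])) + 1
        \<le> int (length (free (inv_word (mirror s) @ (g' @ [y]) @ s))) + \<bar>n - slope [y] - slope s\<bar>"
      using Cons.prems(1) s(1) unfolding g' by (intro Cons.IH balanced_rotate)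
    ultimately show ?thesis using slope_Cons[of y s] by (simp add: g' algebra_simps)
  next
    case 2
    then obtain g' where g': "g = g' @ [inv_letter y]" using g(1) by (metis append_butlast_last_id)
    have "push (inv_letter y) (push y (act s [])) = act s []"
      using push_cancel[of _ "inv_letter y"] by (simp add: reduced_act)
    then have "free (inv_word (mirror (y # s)) @ g @ y # s)
        = free (inv_word (mirror s) @ (inv_letter (mirror_letter y) # g') @ s)"
      by (simp add: free_def g')
    moreover have "int (length (inv_letter (mirror_letter y) # g')) + 1
        \<le> int (length (free (inv_word (mirror s) @ (inv_letter (mirror_letter y) # g') @ s))) + \<bar>n - slope [y] - slope s\<bar>"
      using Cons.prems(1) s(1) unfolding g' by (intro Cons.IH balanced_rotate_back)
    ultimately show ?thesis using slope_Cons[of y s] by (simp add: g' algebra_simps)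
  next
    case 3
    define u where "u = inv_word (mirror (y # s))"
    have u: "reduced u" "u \<noteq> []" "last u = inv_letter (mirror_letter y)" "length u = length (y # s)"
      using reduced_inv_word[OF reduced_mirror[OF Cons.prems(2)]] by (auto simp: u_def)
    have "y \<noteq> inv_letter (last g)" using 3(2) by auto
    then have "reduced (g @ y # s)" using g(2) Cons.prems(2) by (simp add: reduced_append)
    then have "reduced (u @ g @ y # s)" using u g(1) 3(1) by (simp add: reduced_append[of u])
    then have "free (inv_word (mirror (y # s)) @ g @ y # s) = u @ g @ y # s"
      unfolding u_def by (rule free_reduced)
    then have "length (free (inv_word (mirror (y # s)) @ g @ y # s)) = length g + 2 * length (y # s)"
      using u(4) by simp
    then show ?thesis using slope_bound[of "y # s"] g(4) by linarith
  qed
qed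

text \<open>Such a word has exactly one central letter, and its free part is already reduced as written; its
  length is the lower bound of \<open>balanced_bound\<close>.\<close>

lemma balanced_imp_ConjGeo:
  assumes "w \<in> words" "balanced (free w) (centre_exp w)" "length w = length (free w) + 1"
  shows "w \<in> ConjGeo gens edges twist_aut"
  unfolding ConjGeo_iff
proof (intro conjI ballI)
  fix x assume "x \<in> words"
  then show "int (length w) \<le> int (length (free (inv_word (twist x) @ w @ x))) + \<bar>centre_exp w - slope x\<bar>"
    using balanced_bound[OF assms(2) reduced_free, of x] assms(3)
    by (simp only: free_twisted_conj slope_free)
qed (rule assms(1))

section \<open>Shortening by twisted rotation\<close>

definition centrals :: "nat word \<Rightarrow> nat" where
  "centrals w = length (filter (\<lambda>l. fst l = 4) w)"

lemma length_free_centrals: "length (free w) + centrals w \<le> length w"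
proof (induction w)
  case (Cons l w)
  then show ?case by (cases "free w") (auto simp: free_def push_def centrals_def)
qed (simp add: free_def centrals_def)

lemma centre_exp_le_centrals: "centre_exp w \<le> int (centrals w)"
proof (induction w)
  case (Cons l w)
  then show ?case by (cases l) (auto simp: centre_exp_def centrals_def)
qed (simp add: centrals_def)

lemma centrals_simps [simp]:
  "centrals (u @ w) = centrals u + centrals w" "centrals (mirror w) = centrals w"
  by (simp_all add: centrals_def filter_map comp_def)

text \<open>Conjugation by \<open>\<sigma>(p)\<close> removes \<open>p\<close> in front, because the automorphism takes \<open>\<sigma>(p)\<close> back to \<open>p\<close> up to
  central letters.\<close>

lemma free_rotate:
  "free (inv_word (twist (mirror p)) @ (p @ q) @ mirror p) = free (q @ mirror p)"
proof -
  have "act p t = act (twist (mirror p)) t" for t by simp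
  then show ?thesis by (simp only: free_def act_simps act_inv_word reduced_act reduced_Nil)
qed

text \<open>The mirror image of the previous rotation: conjugation by \<open>q\<^sup>-\<^sup>1\<close> carries the suffix \<open>q\<close> to the
  front.\<close>

lemma free_rotate_back:
  "free (inv_word (twist (inv_word q)) @ (p @ q) @ inv_word q) = free (mirror q @ p)"
proof -
  define s where "s = act p []"
  have s: "reduced s" by (simp add: s_def reduced_act)
  have "act (twist (inv_word q)) (act (mirror q) s) = s"
    using s by (simp flip: inv_word_mirror)
  then have "act (inv_word (twist (inv_word q))) s = act (mirror q) s"
    using s by (metis act_inv_word(2) reduced_act)
  then show ?thesis by (simp add: free_def s_def)
qed

text \<open>Moving a part of slope \<open>-1\<close> to the other end lowers the positive central exponent by one and adds no
  letters to the free part, so the conjugate is shorter.\<close>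

lemma ConjGeo_slopes:
  assumes "p @ q \<in> ConjGeo gens edges twist_aut" "1 \<le> centre_exp (p @ q)"
  shows "slope p \<noteq> - 1" "slope q \<noteq> - 1"
proof -
  let ?w = "p @ q"
  have w: "p \<in> words" "q \<in> words" using assms(1) by (auto simp: ConjGeo_iff)
  have min: "int (length ?w) \<le> int (length (free (inv_word (twist x) @ ?w @ x))) + \<bar>centre_exp ?w - slope x\<bar>"
    if "x \<in> words" for x
    using assms(1) that unfolding ConjGeo_iff by blast
  have z: "centre_exp ?w \<le> int (centrals p + centrals q)" using centre_exp_le_centrals[of ?w] by simp
  show "slope p \<noteq> - 1"
  proof
    assume "slope p = - 1"
    then show False
      using min[of "mirror p"] w(1) length_free_centrals[of "q @ mirror p"] z assms(2)
      unfolding free_rotate by simp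
  qed
  show "slope q \<noteq> - 1"
  proof
    assume "slope q = - 1"
    then show False
      using min[OF inv_word_closed[OF w(2)]] length_free_centrals[of "mirror q @ p"] z assms(2)
      unfolding free_rotate_back by simp
  qed
qed

section \<open>Pumping sorted positive words\<close>

abbreviation pos :: "nat list \<Rightarrow> nat word" where "pos \<equiv> map (\<lambda>v. (v, True))"

lemma sorted_blocks:
  assumes "sorted ns" "set ns \<subseteq> {0, 1, 2, 4 :: nat}"
  shows "ns = replicate (count_list ns 0) 0 @ replicate (count_list ns 1) 1 @
    replicate (count_list ns 2) 2 @ replicate (count_list ns 4) 4"
  using assms
proof (induction ns)
  case (Cons k ns)
  have IH: "ns = replicate (count_list ns 0) 0 @ replicate (count_list ns 1) 1 @
    replicate (count_list ns 2) 2 @ replicate (count_list ns 4) 4"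
    using Cons by simp
  have "count_list ns j = 0" if "j < k" for j
    using Cons.prems(1) that by (auto simp: count_list_0_iff)
  moreover have "k = 0 \<or> k = 1 \<or> k = 2 \<or> k = 4" using Cons.prems(2) by auto
  ultimately show ?case
    by (elim disjE) (subst (1) IH, simp)+
qed simp

lemma count_list_replicate: "count_list (replicate n k) l = (if k = l then n else 0)"
  by (induction n) auto

lemma slope_blocks [simp]: "slope (pos (replicate n k)) = int n * charge k"
  by (simp add: slope_def)

lemma charge_simps [simp]:
  "charge 0 = 1" "charge (Suc 0) = - 1" "charge 2 = 1"
  by (simp_all add: charge_def)

text \<open>If the generator 1 outnumbers 0, the prefix that ends just after it takes the lead has slope \<open>-1\<close>;
  if it outnumbers 2, the same holds for a suffix.\<close>

lemma ConjGeo_pos_counts: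
  assumes "sorted ns" "set ns \<subseteq> {0, 1, 2, 4}" "4 \<in> set ns" "pos ns \<in> ConjGeo gens edges twist_aut"
  shows "count_list ns 1 \<le> count_list ns 0" "count_list ns 1 \<le> count_list ns 2"
proof -
  define i j k m where d: "i = count_list ns 0" "j = count_list ns 1" "k = count_list ns 2"
    "m = count_list ns 4"
  have ns: "ns = replicate i 0 @ replicate j 1 @ replicate k 2 @ replicate m 4"
    using sorted_blocks[OF assms(1,2)] by (simp add: d)
  have "1 \<le> m" using assms(3) by (simp add: d Suc_le_eq) (metis count_list_0_iff neq0_conv)
  then have z: "1 \<le> centre_exp (pos ns)" by (simp add: ns centre_exp_def)
  have "False" if "i < j"
  proof -
    let ?p = "pos (replicate i 0 @ replicate (Suc i) 1)"
    let ?q = "pos (replicate (j - Suc i) 1 @ replicate k 2 @ replicate m 4)"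
    have "replicate j (1 :: nat) = replicate (Suc i) 1 @ replicate (j - Suc i) 1"
      using that by (simp only: flip: replicate_add) simp
    then have "pos ns = ?p @ ?q" by (simp only: ns map_append append_assoc)
    moreover have "slope ?p = - 1" by (simp only: map_append slope_simps slope_blocks) simp
    ultimately show False using ConjGeo_slopes(1)[of ?p ?q] assms(4) z by argo
  qed
  then show "count_list ns 1 \<le> count_list ns 0" by (fold d) (meson not_less)
  have "False" if "k < j"
  proof -
    let ?p = "pos (replicate i 0 @ replicate (j - Suc k) 1)"
    let ?q = "pos (replicate (Suc k) 1 @ replicate k 2 @ replicate m 4)"
    have "replicate j (1 :: nat) = replicate (j - Suc k) 1 @ replicate (Suc k) 1"
      using that by (simp only: flip: replicate_add) simp
    then have "pos ns = ?p @ ?q" by (simp only: ns map_append append_assoc)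
    moreover have "slope ?q = - 1" by (simp only: map_append slope_simps slope_blocks) simp
    ultimately show False using ConjGeo_slopes(2)[of ?p ?q] assms(4) z by argo
  qed
  then show "count_list ns 1 \<le> count_list ns 2" by (fold d) (meson not_less)
qed

definition block_word :: "nat \<Rightarrow> nat list" where
  "block_word n = replicate n 0 @ replicate n 1 @ replicate n 2 @ [4]"

lemma block_word_ConjGeo:
  assumes "0 < n"
  shows "pos (block_word n) \<in> ConjGeo gens edges twist_aut"
proof -
  let ?w = "pos (block_word n)"
  let ?g = "pos (replicate n 0 @ replicate n 1 @ replicate n 2)"
  have w: "?w \<in> words" by (auto simp: block_word_def letters_def gens_def)
  have pos_g: "\<forall>l\<in>set ?g. snd l \<and> fst l \<noteq> 4" by auto
  have "?w = ?g @ [(4, True)]" by (simp add: block_word_def)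
  then have free: "free ?w = ?g"
    using act_reduced[OF reduced_positive[OF pos_g]] by (simp only: free_def act_simps) (simp add: push_def)
  have "0 \<le> slope p \<and> 0 \<le> slope q" if e: "?g = p @ q" for p q
  proof -
    define k where "k = length p"
    have p: "p = take k ?g" and q: "q = drop k ?g" unfolding e k_def by simp_all
    \<comment> \<open>A prefix of length \<open>k\<close> meets the three blocks in \<open>k\<close>, \<open>k - n\<close> and \<open>k - 2 n\<close> letters, cut off below
      at 0 by truncated subtraction and above at \<open>n\<close>.\<close>
    have "slope p = int (min k n) - int (min (k - n) n) + int (min (k - 2 * n) n)"
      unfolding p by (simp only: take_map map_append take_append slope_simps) (simp add: take_map slope_def)
    moreover have "slope q = int (n - k) - int (n - (k - n)) + int (n - (k - 2 * n))"
      unfolding q by (simp only: drop_map map_append drop_append slope_simps) (simp add: drop_map slope_def)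
    ultimately show ?thesis by linarith
  qed
  moreover have "centre_exp ?w = 1" by (simp add: block_word_def centre_exp_def)
  ultimately have "balanced (free ?w) (centre_exp ?w)"
    using pos_g assms unfolding free balanced_def by simp
  then show ?thesis using w by (intro balanced_imp_ConjGeo) (simp_all add: free, simp add: block_word_def)
qed

text \<open>In a pumped factorization of \<open>0\<^sup>n 1\<^sup>n 2\<^sup>n 4\<close> each pumped factor is a power of one generator, and not
  of 4, which occurs only once. Deleting the factors and doubling them gives opposite inequalities
  between the numbers of 0, 1 and 2 in the factors, so the three numbers agree. Two factors cannot
  provide three different generators, hence both are empty.\<close>

lemma ConjGeo_not_context_free: "\<not> context_free (ConjGeo gens edges twist_aut)"
proof
  let ?L = "ConjGeo gens edges twist_aut"
  assume "context_free ?L"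
  from content_pumping[OF this] obtain N where
    N: "\<And>w. w \<in> ?L \<Longrightarrow> N < length w \<Longrightarrow> \<exists>u v x y t. w = u @ v @ x @ y @ t \<and> v @ y \<noteq> [] \<and>
      set v \<union> set y \<subseteq> set x \<and> u @ x @ t \<in> ?L \<and> u @ v @ v @ x @ y @ y @ t \<in> ?L"
    by blast
  define n where "n = Suc N"
  have "N < length (pos (block_word n))" by (simp add: block_word_def n_def)
  then obtain u' v' x' y' t' where
    w: "pos (block_word n) = u' @ v' @ x' @ y' @ t'" and "v' @ y' \<noteq> []" "set v' \<union> set y' \<subseteq> set x'"
    "u' @ x' @ t' \<in> ?L" "u' @ v' @ v' @ x' @ y' @ y' @ t' \<in> ?L"
    using N block_word_ConjGeo[of n] by (metis n_def zero_less_Suc)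
  moreover from w obtain u v x y t where b: "block_word n = u @ v @ x @ y @ t" and
    "u' = pos u" "v' = pos v" "x' = pos x" "y' = pos y" "t' = pos t"
    by (auto simp: map_eq_append_conv append_eq_map_conv)
  ultimately have ne: "v @ y \<noteq> []" and content: "set v \<union> set y \<subseteq> set x"
    and down: "pos (u @ x @ t) \<in> ?L" and up: "pos (u @ v @ v @ x @ y @ y @ t) \<in> ?L"
    by auto
  have "sorted (block_word n)" by (auto simp: block_word_def sorted_append)
  then have sorted: "sorted (u @ v @ x @ y @ t)" by (simp add: b)
  have "set (block_word n) \<subseteq> {0, 1, 2, 4}" by (auto simp: block_word_def)
  then have letters: "set (u @ v @ x @ y @ t) \<subseteq> {0, 1, 2, 4}" by (simp add: b)
  have counts: "count_list u k + count_list v k + count_list x k + count_list y k + count_list t k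
      = count_list (block_word n) k" for k
    by (simp add: b)
  have count_b: "count_list (block_word n) 0 = n" "count_list (block_word n) 1 = n"
    "count_list (block_word n) 2 = n" "count_list (block_word n) 4 = 1"
    by (simp_all add: block_word_def count_list_replicate)
  have le: "a \<le> b" if "a \<in> set v \<and> b \<in> set x \<or> a \<in> set x \<and> b \<in> set y" for a b
    using sorted that by (auto simp: sorted_append)
  \<comment> \<open>Every letter of \<open>v\<close> and of \<open>y\<close> recurs in \<open>x\<close>, which lies after \<open>v\<close> and before \<open>y\<close>.\<close>
  have pure: "k = l" if "k \<in> set v \<and> l \<in> set v \<or> k \<in> set y \<and> l \<in> set y" for k l
  proof (rule antisym)
    have "k \<in> set x" "l \<in> set x" using that content by auto
    then show "k \<le> l" "l \<le> k" using that le by blast+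
  qed
  have no4: "4 \<notin> set v" "4 \<notin> set y"
  proof -
    have pos: "count_list z 4 > 0" if "4 \<in> set z" for z :: "nat list"
      using that by (metis count_list_0_iff neq0_conv)
    have "count_list v 4 + count_list x 4 + count_list y 4 \<le> 1" using counts[of 4] count_b(4) by simp
    moreover have "4 \<in> set x" if "4 \<in> set v \<or> 4 \<in> set y" using that content by blast
    ultimately show "4 \<notin> set v" "4 \<notin> set y" using pos[of v] pos[of x] pos[of y] by linarith+
  qed
  have has4: "4 \<in> set (u @ x @ t)"
  proof -
    have "4 \<in> set (block_word n)" by (simp add: block_word_def)
    then show ?thesis using no4 by (simp add: b)
  qed
  have sorted_down: "sorted (u @ x @ t)" using sorted by (auto simp: sorted_append)
  have "a \<le> b" if "a \<in> set v \<and> b \<in> set v \<or> a \<in> set y \<and> b \<in> set y" for a b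
    using pure[OF that] by simp
  then have sorted_up: "sorted (u @ v @ v @ x @ y @ y @ t)"
    using sorted by (auto simp: sorted_append)
  have set_down: "set (u @ x @ t) \<subseteq> {0, 1, 2, 4}"
    and set_up: "set (u @ v @ v @ x @ y @ y @ t) \<subseteq> {0, 1, 2, 4}"
    and up4: "4 \<in> set (u @ v @ v @ x @ y @ y @ t)"
    using letters has4 by auto
  note down_counts = ConjGeo_pos_counts[OF sorted_down set_down has4 down, unfolded count_list_append]
  note up_counts = ConjGeo_pos_counts[OF sorted_up set_up up4 up, unfolded count_list_append]
  have balance: "count_list v 0 + count_list y 0 = count_list v 1 + count_list y 1"
    "count_list v 2 + count_list y 2 = count_list v 1 + count_list y 1"
    using down_counts up_counts counts[of 0] counts[of 1] counts[of 2]
    unfolding count_b by linarith+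
  have excl: "count_list v k = 0 \<or> count_list v l = 0" "count_list y k = 0 \<or> count_list y l = 0"
    if "k \<noteq> l" for k l
    using pure[of k l] that unfolding count_list_0_iff by blast+
  have "count_list v 1 + count_list y 1 = 0"
    using balance excl[of 0 1] excl[of 0 2] excl[of 1 2] by simp linarith
  then have "count_list v k = 0 \<and> count_list y k = 0" if "k \<in> {0, 1, 2}" for k
    using balance that by auto
  then have "k \<notin> set v \<union> set y" if "k \<in> {0, 1, 2, 4}" for k
    using that no4 unfolding count_list_0_iff by blast
  moreover have "set v \<union> set y \<subseteq> {0, 1, 2, 4}" using letters by auto
  ultimately have "set v \<union> set y = {}" by (meson equals0I subsetD)
  then show False using ne by simp
qed

theorem corollary5p14:
  shows "\<exists>(V :: nat set) E \<phi> m A.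
    finite_simple_graph V E \<and>
    \<phi> \<in> auto (raag V E) \<and>
    0 < m \<and> (\<forall>g \<in> carrier (raag V E). (\<phi> ^^ m) g = g) \<and>
    A = virtual_raag V E \<phi> m \<and> group A \<and>
    \<not> length_preserving V E \<phi> \<and>
    \<not> context_free (ConjGeo V E \<phi>)"
proof (intro exI conjI)
  show "finite_simple_graph gens edges"
    by (auto simp: finite_simple_graph_def gens_def edges_def)
  show order: "\<forall>g \<in> carrier (raag gens edges). (twist_aut ^^ 2) g = g"
    by (simp add: twist_aut_twist_aut numeral_2_eq_2)
  show "group (virtual_raag gens edges twist_aut 2)"
    by (rule group_virtual_raag[OF twist_aut_auto _ order]) simp
qed (rule twist_aut_auto refl twist_aut_not_length_preserving ConjGeo_not_context_free | simp)+

end
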